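(* The sets $\mathcal{Y}_3=\{S_3,C_2,Z_2\}$, $\mathcal{N}_{3,1}=\{L_2\}$, $\mathcal{N}_{3,2}=\{S_3,Z_2\}$, $\mathcal{N}_{3,3}=\{S_3,C_2,P_{5,10}\}$ and $\mathcal{N}_{3,4}=\{S_4,C_2,Z_2\}$ form a characterizing collection of winners and losers for size $3$ teams; that is, $\mathcal{Y}_3$ is a winning team, each $\mathcal{N}_{3,i}$ ($1\le i\le4$) is a losing team, and for every team $\mathcal{F}$ with exactly $3$ elements, either $\mathcal{F}\preceq\mathcal{Y}_3$ or $\mathcal{N}_{3,i}\preceq\mathcal{F}$ for some $i\in\{1,2,3,4\}$. (Consequently a team of size $3$ is a winner if and only if it is simpler than $\mathcal{Y}_3$.)
   Context: Board and polyominoes. The cells are the translates of the unit square $[0,1]\times[0,1]$ by vectors of $\mathbf{Z}^2$; identify a cell with the vector in $\mathbf{Z}^2$. Two cells are adjacent if they share an edge. A polyomino is a nonempty (finite or infinite) set of cells that is connected through adjacent cells, considered up to congruence (translations, rotations, reflections of the board). Game. Two players, maker (moving first) and breaker, alternately mark previously unmarked cells of the infinite board: in each turn the maker marks 1 cell and the breaker marks 2 cells. For a set $\mathcal{S}$ of finite polyominoes, the maker wins if after finitely many moves he has marked all the cells of a set congruent to some element of $\mathcal{S}$; the breaker wins if she prevents this. $\mathcal{S}$ is a winner (winning) if the maker has a winning strategy. Ancestors. $P\sqsubseteq Q$ ($P$ is an ancestor of $Q$) means that some congruent copy of $P$ is a subset of $Q$. A team is a set of polyominoes no element of which is an ancestor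 of another element; its size is its number of elements. Unbounded sets. A set of polyominoes is unbounded if it contains an infinite polyomino. If $\mathcal{T}$ is unbounded and $F_T$ is a finite ancestor of $T$ for each $T\in\mathcal{T}$, then $\{F_T\mid T\in\mathcal{T}\}$ is a bounded restriction of $\mathcal{T}$. An unbounded set is a winner if each of its bounded restrictions is a winner. A set that is not a winner is a loser (losing). Simpler. $\mathcal{S}\preceq\mathcal{T}$ ($\mathcal{S}$ is simpler than $\mathcal{T}$) means that for all $Q\in\mathcal{T}$ there is $P\in\mathcal{S}$ with $P\sqsubseteq Q$. Particular polyominoes (up to congruence): $S_n=\{(0,0),\dots,(n-1,0)\}$; $L_2=\{(0,0),(1,0),(0,1)\}$; $C_2=\{(0,0),(1,0),(0,1),(1,1)\}$; $Z_2=\{(0,0),(1,0),(0,1),(1,-1)\}$; $P_{5,10}=\{(0,0),(1,0),(1,1),(2,1),(2,2)\}$ (the staircase polyomino with five cells). *)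

theory Defs
  imports Main
begin

section \<open>Cells, congruence, polyominoes\<close>

text \<open>A cell is identified with the integer vector translating the unit square onto it.
  Polyominoes are handled through representatives: a polyomino is a concrete cell set, and
  every notion below that depends on one is invariant under congruence.\<close>

type_synonym cell = "int \<times> int"

definition adjacent :: "cell \<Rightarrow> cell \<Rightarrow> bool" where
  "adjacent p q \<longleftrightarrow> \<bar>fst p - fst q\<bar> + \<bar>snd p - snd q\<bar> = 1"

text \<open>The group generated by the translations, the quarter turn and a reflection consists of
  all symmetries of the board.\<close>

inductive_set board_symmetries :: "(cell \<Rightarrow> cell) set" where
  translation: "(\<lambda>(x, y). (x + a, y + b)) \<in> board_symmetries"
| rotation: "(\<lambda>(x, y). (- y, x)) \<in> board_symmetries"
| reflection: "(\<lambda>(x, y). (- x, y)) \<in> board_symmetries"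
| composition: "f \<in> board_symmetries \<Longrightarrow> g \<in> board_symmetries \<Longrightarrow> f \<circ> g \<in> board_symmetries"

definition congruent :: "cell set \<Rightarrow> cell set \<Rightarrow> bool" where
  "congruent P Q \<longleftrightarrow> (\<exists>f\<in>board_symmetries. Q = f ` P)"

definition polyomino :: "cell set \<Rightarrow> bool" where
  "polyomino P \<longleftrightarrow> P \<noteq> {} \<and>
     (\<forall>p\<in>P. \<forall>q\<in>P. (p, q) \<in> {(u, v). u \<in> P \<and> v \<in> P \<and> adjacent u v}\<^sup>*)"

definition ancestor :: "cell set \<Rightarrow> cell set \<Rightarrow> bool"  (infix "\<sqsubseteq>" 50) where
  "P \<sqsubseteq> Q \<longleftrightarrow> (\<exists>P'. congruent P P' \<and> P' \<subseteq> Q)"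

text \<open>Congruent cell sets are ancestors of each other, so distinct members of a team are never
  congruent; hence the cardinality of a team of representatives is the number of
  polyominoes up to congruence.\<close>

definition team :: "cell set set \<Rightarrow> bool" where
  "team \<S> \<longleftrightarrow> (\<forall>P\<in>\<S>. polyomino P) \<and> (\<forall>P\<in>\<S>. \<forall>Q\<in>\<S>. P \<noteq> Q \<longrightarrow> \<not> P \<sqsubseteq> Q)"

definition simpler :: "cell set set \<Rightarrow> cell set set \<Rightarrow> bool"  (infix "\<preceq>" 50) where
  "\<S> \<preceq> \<T> \<longleftrightarrow> (\<forall>Q\<in>\<T>. \<exists>P\<in>\<S>. P \<sqsubseteq> Q)"


section \<open>The game\<close>

text \<open>A strategy of the maker assigns to the list of the breaker's previous moves the next
  cell to be marked; his own previous moves are determined by this list. A sequence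
  \<open>b\<close> lists the breaker's moves, the set \<open>b n\<close> being marked in round \<open>n\<close> right after the
  maker's move in that round.\<close>

type_synonym strategy = "cell set list \<Rightarrow> cell"

definition maker_move :: "strategy \<Rightarrow> (nat \<Rightarrow> cell set) \<Rightarrow> nat \<Rightarrow> cell" where
  "maker_move \<sigma> b n = \<sigma> (map b [0..<n])"

definition maker_marks :: "strategy \<Rightarrow> (nat \<Rightarrow> cell set) \<Rightarrow> nat \<Rightarrow> cell set" where
  "maker_marks \<sigma> b n = maker_move \<sigma> b ` {..<n}"

definition breaker_marks :: "(nat \<Rightarrow> cell set) \<Rightarrow> nat \<Rightarrow> cell set" where
  "breaker_marks b n = (\<Union>k<n. b k)"

definition legal_maker :: "strategy \<Rightarrow> (nat \<Rightarrow> cell set) \<Rightarrow> nat \<Rightarrow> bool" where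
  "legal_maker \<sigma> b n \<longleftrightarrow> maker_move \<sigma> b n \<notin> maker_marks \<sigma> b n \<union> breaker_marks b n"

definition legal_breaker :: "strategy \<Rightarrow> (nat \<Rightarrow> cell set) \<Rightarrow> nat \<Rightarrow> bool" where
  "legal_breaker \<sigma> b n \<longleftrightarrow>
     card (b n) = 2 \<and> b n \<inter> (maker_marks \<sigma> b (Suc n) \<union> breaker_marks b n) = {}"

text \<open>Plays are continued forever, also after the maker has reached his goal; as the board is
  infinite, legal moves never run out, so this does not affect who wins.\<close>

definition winning_strategy :: "cell set set \<Rightarrow> strategy \<Rightarrow> bool" where
  "winning_strategy \<S> \<sigma> \<longleftrightarrow>
     (\<forall>b. (\<forall>n. legal_breaker \<sigma> b n) \<longrightarrow>
        (\<forall>n. legal_maker \<sigma> b n) \<and>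
        (\<exists>n. \<exists>P\<in>\<S>. \<exists>Q. congruent P Q \<and> Q \<subseteq> maker_marks \<sigma> b n))"

definition maker_wins :: "cell set set \<Rightarrow> bool" where
  "maker_wins \<S> \<longleftrightarrow> (\<exists>\<sigma>. winning_strategy \<S> \<sigma>)"

definition unbounded :: "cell set set \<Rightarrow> bool" where
  "unbounded \<T> \<longleftrightarrow> (\<exists>T\<in>\<T>. infinite T)"

definition bounded_restriction :: "cell set set \<Rightarrow> cell set set \<Rightarrow> bool" where
  "bounded_restriction \<R> \<T> \<longleftrightarrow> unbounded \<T> \<and>
     (\<exists>F. (\<forall>T\<in>\<T>. polyomino (F T) \<and> finite (F T) \<and> F T \<sqsubseteq> T) \<and> \<R> = F ` \<T>)"

definition winner :: "cell set set \<Rightarrow> bool" where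
  "winner \<S> \<longleftrightarrow>
     (if unbounded \<S> then \<forall>\<R>. bounded_restriction \<R> \<S> \<longrightarrow> maker_wins \<R> else maker_wins \<S>)"

abbreviation loser :: "cell set set \<Rightarrow> bool" where
  "loser \<S> \<equiv> \<not> winner \<S>"


section \<open>Particular polyominoes and teams\<close>

definition S_poly :: "nat \<Rightarrow> cell set" where
  "S_poly n = (\<lambda>i. (int i, 0)) ` {..<n}"

definition L_2 :: "cell set" where
  "L_2 = {(0, 0), (1, 0), (0, 1)}"

definition C_2 :: "cell set" where
  "C_2 = {(0, 0), (1, 0), (0, 1), (1, 1)}"

definition Z_2 :: "cell set" where
  "Z_2 = {(0, 0), (1, 0), (0, 1), (1, -1)}"

definition P_5_10 :: "cell set" where
  "P_5_10 = {(0, 0), (1, 0), (1, 1), (2, 1), (2, 2)}"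

definition Y_3 :: "cell set set" where
  "Y_3 = {S_poly 3, C_2, Z_2}"

definition N_3_1 :: "cell set set" where
  "N_3_1 = {L_2}"

definition N_3_2 :: "cell set set" where
  "N_3_2 = {S_poly 3, Z_2}"

definition N_3_3 :: "cell set set" where
  "N_3_3 = {S_poly 3, C_2, P_5_10}"

definition N_3_4 :: "cell set set" where
  "N_3_4 = {S_poly 4, C_2, Z_2}"

end

theory Submission
  imports Defs
begin

text \<open>The maker plays greedily on \<open>Y_3\<close>: he completes a goal if he can and otherwise marks any free
  neighbour of his set. A domino has six neighbours, of which the breaker has marked at most four;
  if an end of the domino is free he gets \<open>S_3\<close>, otherwise a corner tromino. All seven neighbours of
  that tromino complete a goal, and the breaker has marked at most six cells.

  Against each of the four losing teams the breaker has a paving: a graph on the cells of maximal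
  degree two such that every copy of a goal contains an edge. She always marks the neighbours of the
  cell just marked by the maker.

  For the classification, adding a cell to a small polyomino leaves few possibilities. A team of size
  three whose members do not all contain \<open>L_2\<close> has exactly one straight member, since straight
  polyominoes are pairwise comparable. If \<open>{S_3, Z_2}\<close> is not simpler than it, then one of the other
  members is \<open>C_2\<close>, and the last member decides between \<open>Y_3\<close> and the remaining two losing teams.\<close>

section \<open>Symmetries of the board\<close>

text \<open>Every board symmetry has this form with \<open>s\<close> and \<open>t\<close> in
  \<open>{1, -1}\<close>: an optional exchange of the coordinates (\<open>w\<close>), then signs,
  then a translation. Integer signs turn statements about all copies of a concrete polyomino into
  eight cases of linear arithmetic.\<close>

definition dihedral :: "bool \<Rightarrow> int \<Rightarrow> int \<Rightarrow> int \<Rightarrow> int \<Rightarrow> cell \<Rightarrow> cell" where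
  "dihedral w s t a b = (\<lambda>(x, y). if w then (s * y + a, t * x + b) else (s * x + a, t * y + b))"

lemma board_symmetries_dihedral:
  assumes "f \<in> board_symmetries"
  obtains w s t a b where "s \<in> {1, -1}" "t \<in> {1, -1}" "f = dihedral w s t a b"
proof -
  have "\<exists>w. \<exists>s\<in>{1, -1}. \<exists>t\<in>{1, -1}. \<exists>a b. f = dihedral w s t a b"
    using assms
  proof (induction rule: board_symmetries.induct)
    case (translation a b)
    have "(\<lambda>(x, y). (x + a, y + b)) = dihedral False 1 1 a b"
      by (auto simp: dihedral_def)
    then show ?case by blast
  next
    case rotation
    have "(\<lambda>(x, y). (- y, x)) = dihedral True (-1) 1 0 0"
      by (auto simp: dihedral_def)
    then show ?case by blast
  next
    case reflection
    have "(\<lambda>(x, y). (- x, y)) = dihedral False (-1) 1 0 0"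
      by (auto simp: dihedral_def)
    then show ?case by blast
  next
    case (composition f g)
    then obtain w s t a b w' s' t' a' b' where f: "f = dihedral w s t a b"
      and g: "g = dihedral w' s' t' a' b'"
      and sgn: "s \<in> {1, -1}" "t \<in> {1, -1}" "s' \<in> {1, -1}" "t' \<in> {1, -1}"
      by blast
    \<comment> \<open>Two exchanges cancel, hence \<open>w \<noteq> w'\<close>; an exchange in the
      outer map \<open>f\<close> makes the signs and offsets of \<open>g\<close> trade
      places.\<close>
    have "f \<circ> g = dihedral (w \<noteq> w') (s * (if w then t' else s')) (t * (if w then s' else t'))
        (s * (if w then b' else a') + a) (t * (if w then a' else b') + b)"
      by (auto simp: f g dihedral_def fun_eq_iff algebra_simps)
    moreover have "s * (if w then t' else s') \<in> {1, -1}" "t * (if w then s' else t') \<in> {1, -1}"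
      using sgn by auto
    ultimately show ?case by blast
  qed
  then show thesis using that by blast
qed

lemma dihedral_board_symmetries:
  assumes "s \<in> {1, -1}" "t \<in> {1, -1}"
  shows "dihedral w s t a b \<in> board_symmetries"
proof -
  let ?R = "\<lambda>(x, y). (- y, x :: int)" and ?M = "\<lambda>(x, y). (- x, y :: int)"
  let ?T = "\<lambda>(x, y). (x + a, y + b)"
  have M: "?M \<in> board_symmetries" and R: "?R \<in> board_symmetries" and T: "?T \<in> board_symmetries"
    by (rule board_symmetries.intros)+
  have id: "(\<lambda>p. p) \<in> board_symmetries"
    using board_symmetries.translation[of 0 0] by (simp add: id_def case_prod_unfold)
  note c = board_symmetries.composition
  consider "s = 1" "t = 1" | "s = 1" "t = -1" | "s = -1" "t = 1" | "s = -1" "t = -1"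
    using assms by blast
  then have "dihedral False s t 0 0 \<in> board_symmetries"
  proof cases
    case 1
    have "dihedral False s t 0 0 = (\<lambda>p. p)" using 1 by (auto simp: dihedral_def)
    then show ?thesis using id by simp
  next
    case 2
    have "dihedral False s t 0 0 = ?M \<circ> (?R \<circ> ?R)" using 2 by (auto simp: dihedral_def)
    then show ?thesis using c[OF M c[OF R R]] by simp
  next
    case 3
    have "dihedral False s t 0 0 = ?M" using 3 by (auto simp: dihedral_def)
    then show ?thesis using M by simp
  next
    case 4
    have "dihedral False s t 0 0 = ?R \<circ> ?R" using 4 by (auto simp: dihedral_def)
    then show ?thesis using c[OF R R] by simp
  qed
  \<comment> \<open>\<open>?M \<circ> ?R\<close> is the exchange of the coordinates, so the factors
    are exchange, signs and translation, from right to left.\<close>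
  moreover have "dihedral w s t a b = ?T \<circ> (dihedral False s t 0 0 \<circ> (if w then ?M \<circ> ?R else (\<lambda>p. p)))"
    by (auto simp: dihedral_def)
  moreover have "(if w then ?M \<circ> ?R else (\<lambda>p. p)) \<in> board_symmetries"
    using c[OF M R] id by auto
  ultimately show ?thesis using c[OF T] c by presburger
qed

lemma board_symmetries_inverse:
  assumes "f \<in> board_symmetries"
  obtains g where "g \<in> board_symmetries" "\<And>p. g (f p) = p" "\<And>p. f (g p) = p"
proof -
  obtain w s t a b where st: "s \<in> {1, -1}" "t \<in> {1, -1}" and f: "f = dihedral w s t a b"
    using board_symmetries_dihedral[OF assms] .
  \<comment> \<open>The signs are their own inverses; undoing an exchange also swaps the signs and
    offsets of the two coordinates.\<close>
  define g where "g = (if w then dihedral True t s (- t * b) (- s * a)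
    else dihedral False s t (- s * a) (- t * b))"
  have "g \<in> board_symmetries"
    unfolding g_def using st dihedral_board_symmetries by auto
  moreover have "g (f p) = p" "f (g p) = p" for p
    using st by (auto simp: g_def f dihedral_def split: prod.splits)
  ultimately show thesis using that by blast
qed

lemma board_symmetries_inj: "f \<in> board_symmetries \<Longrightarrow> inj f"
  by (metis board_symmetries_inverse injI)

lemma board_symmetries_adjacent:
  assumes "f \<in> board_symmetries"
  shows "adjacent (f p) (f q) \<longleftrightarrow> adjacent p q"
proof -
  obtain w s t a b where st: "s \<in> {1, -1}" "t \<in> {1, -1}" and f: "f = dihedral w s t a b"
    using board_symmetries_dihedral[OF assms] .
  show ?thesis
    using st by (cases p; cases q) (auto simp: f dihedral_def adjacent_def)
qed

lemma congruent_refl: "congruent P P"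
proof -
  have "id \<in> board_symmetries"
    using board_symmetries.translation[of 0 0] by (simp add: id_def case_prod_unfold)
  then show ?thesis by (auto simp: congruent_def intro!: bexI[of _ id])
qed

lemma congruent_sym: "congruent P Q \<Longrightarrow> congruent Q P"
proof -
  assume "congruent P Q"
  then obtain f where f: "f \<in> board_symmetries" and Q: "Q = f ` P"
    by (auto simp: congruent_def)
  obtain g where g: "g \<in> board_symmetries" and gf: "\<And>p. g (f p) = p"
    by (rule board_symmetries_inverse[OF f]) blast
  have "P = g ` Q"
    by (simp add: Q image_image gf)
  with g show "congruent Q P"
    by (auto simp: congruent_def)
qed

lemma congruent_trans: "congruent P Q \<Longrightarrow> congruent Q R \<Longrightarrow> congruent P R"
  unfolding congruent_def by (metis board_symmetries.composition image_comp)

lemma ancestor_iff: "P \<sqsubseteq> Q \<longleftrightarrow> (\<exists>f\<in>board_symmetries. f ` P \<subseteq> Q)"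
  by (auto simp: ancestor_def congruent_def)

lemma ancestor_refl: "P \<sqsubseteq> P"
  using congruent_refl by (auto simp: ancestor_def)

lemma ancestor_trans:
  assumes "P \<sqsubseteq> Q" "Q \<sqsubseteq> R"
  shows "P \<sqsubseteq> R"
proof -
  obtain f g where "f \<in> board_symmetries" "f ` P \<subseteq> Q" "g \<in> board_symmetries" "g ` Q \<subseteq> R"
    using assms by (auto simp: ancestor_iff)
  then have "g \<circ> f \<in> board_symmetries" "(g \<circ> f) ` P \<subseteq> R"
    by (auto intro: board_symmetries.composition)
  then show ?thesis unfolding ancestor_iff by blast
qed

lemma congruent_ancestor: "congruent P Q \<Longrightarrow> P \<sqsubseteq> Q"
  by (auto simp: ancestor_def)

lemma congruent_ancestor': "congruent P Q \<Longrightarrow> Q \<sqsubseteq> P"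
  by (simp add: congruent_ancestor congruent_sym)

lemma simpler_trans: "\<S> \<preceq> \<T> \<Longrightarrow> \<T> \<preceq> \<U> \<Longrightarrow> \<S> \<preceq> \<U>"
  unfolding simpler_def by (meson ancestor_trans)

lemma ancestor_dihedralI:
  assumes "dihedral w s t a b ` P \<subseteq> Q" "s \<in> {1, -1}" "t \<in> {1, -1}"
  shows "P \<sqsubseteq> Q"
  unfolding ancestor_iff using assms by (intro bexI[OF _ dihedral_board_symmetries])

lemma ancestorE:
  assumes "P \<sqsubseteq> Q"
  obtains w s t a b where "s \<in> {1, -1}" "t \<in> {1, -1}" "dihedral w s t a b ` P \<subseteq> Q"
proof -
  obtain f where f: "f \<in> board_symmetries" "f ` P \<subseteq> Q"
    using assms by (auto simp: ancestor_iff)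
  show thesis
    by (rule board_symmetries_dihedral[OF f(1)]) (use f(2) that in simp)
qed


section \<open>The four breaker pavings\<close>

lemma winning_strategy_iff:
  "winning_strategy \<S> \<sigma> \<longleftrightarrow>
     (\<forall>b. (\<forall>n. legal_breaker \<sigma> b n) \<longrightarrow>
        (\<forall>n. legal_maker \<sigma> b n) \<and> (\<exists>n. \<exists>P\<in>\<S>. P \<sqsubseteq> maker_marks \<sigma> b n))"
  unfolding winning_strategy_def ancestor_def by blast

text \<open>The same strategy serves: a copy of a member of \<open>\<T>\<close> contains a copy of a
  member of \<open>\<S>\<close>.\<close>

lemma maker_wins_simpler:
  assumes "maker_wins \<T>" "\<S> \<preceq> \<T>"
  shows "maker_wins \<S>"
proof -
  obtain \<sigma> where "winning_strategy \<T> \<sigma>"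
    using assms(1) by (auto simp: maker_wins_def)
  then have "winning_strategy \<S> \<sigma>"
    using assms(2) unfolding winning_strategy_iff simpler_def by (meson ancestor_trans)
  then show ?thesis by (auto simp: maker_wins_def)
qed

text \<open>The breaker has to mark exactly two cells even when fewer cells of \<open>r c\<close>
  are free, so the reply is filled up with arbitrary free cells.\<close>

lemma breaker_reply_exists:
  fixes r :: "cell \<Rightarrow> cell set"
  assumes "finite (r c)" "card (r c) \<le> 2" "finite X"
  shows "\<exists>B. card B = 2 \<and> B \<inter> X = {} \<and> r c - X \<subseteq> B"
proof -
  have inf: "infinite (UNIV :: cell set)"
    by (simp add: infinite_UNIV_char_0 finite_prod)
  have "card (r c - X) \<le> 2"
    using assms card_mono[of "r c" "r c - X"] by auto
  moreover have "infinite (- (X \<union> r c))"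
    using inf assms finite_compl[of "X \<union> r c"] by blast
  then obtain E where "E \<subseteq> - (X \<union> r c)" "card E = 2 - card (r c - X)" "finite E"
    using infinite_arbitrarily_large by metis
  moreover from this have "card ((r c - X) \<union> E) = card (r c - X) + card E"
    using assms by (intro card_Un_disjoint) auto
  ultimately show ?thesis
    by (intro exI[of _ "(r c - X) \<union> E"]) auto
qed

text \<open>The strategy of the maker is fixed, so the breaker's earlier moves determine the whole
  position; this turns a reply rule on histories into a sequence of moves.\<close>

lemma history_recursion:
  fixes F :: "'a list \<Rightarrow> 'a"
  obtains b where "\<And>n. b n = F (map b [0..<n])"
proof -
  define hist where "hist = rec_nat [] (\<lambda>_ h. h @ [F h])"
  have hist: "hist 0 = []" "\<And>n. hist (Suc n) = hist n @ [F (hist n)]"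
    by (simp_all add: hist_def)
  have *: "map (\<lambda>k. F (hist k)) [0..<n] = hist n" for n
    by (induction n) (simp_all add: hist)
  show thesis
    by (rule that[of "\<lambda>k. F (hist k)"]) (simp only: *)
qed

text \<open>The breaker answers a cell by marking all cells related to it by \<open>r\<close>, so the maker
  never gets two related cells.\<close>

lemma paving_breaker_wins:
  fixes r :: "cell \<Rightarrow> cell set"
  assumes fin: "\<And>c. finite (r c)" and card: "\<And>c. card (r c) \<le> 2"
    and sym: "\<And>c d. d \<in> r c \<Longrightarrow> c \<in> r d"
    and paved: "\<And>P Q. P \<in> \<S> \<Longrightarrow> congruent P Q \<Longrightarrow> \<exists>c\<in>Q. \<exists>d\<in>Q. c \<noteq> d \<and> d \<in> r c"
  shows "\<not> maker_wins \<S>"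
proof
  assume "maker_wins \<S>"
  then obtain \<sigma> where \<sigma>: "winning_strategy \<S> \<sigma>"
    by (auto simp: maker_wins_def)
  \<comment> \<open>All cells marked when the breaker replies to history \<open>h\<close>. The
    maker's moves are recovered from the prefixes of \<open>h\<close>; the full prefix, his latest
    move, is included.\<close>
  define X where "X h = (\<lambda>k. \<sigma> (take k h)) ` {..length h} \<union> \<Union>(set h)" for h
  define F where "F h = (SOME B. card B = 2 \<and> B \<inter> X h = {} \<and> r (\<sigma> h) - X h \<subseteq> B)" for h
  from history_recursion[of F] obtain b where b: "\<And>n. b n = F (map b [0..<n])"
    by blast
  have X: "X (map b [0..<n]) = maker_marks \<sigma> b (Suc n) \<union> breaker_marks b n" for n
  proof -
    have "\<sigma> (take k (map b [0..<n])) = maker_move \<sigma> b k" if "k \<le> n" for k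
      using that by (simp add: maker_move_def take_map)
    then have "(\<lambda>k. \<sigma> (take k (map b [0..<n]))) ` {..n} = maker_move \<sigma> b ` {..n}"
      by (intro image_cong) auto
    then show ?thesis
      by (auto simp: X_def maker_marks_def breaker_marks_def lessThan_Suc_atMost)
  qed
  have reply: "card (b n) = 2 \<and> b n \<inter> X (map b [0..<n]) = {} \<and>
      r (maker_move \<sigma> b n) - X (map b [0..<n]) \<subseteq> b n" for n
  \<comment> \<open>\<open>F\<close> chooses a correct reply only if the set of marked cells is
    finite, which rests on the correctness of all earlier replies.\<close>
  proof (induction n rule: less_induct)
    case (less n)
    have "finite (b k)" if "k < n" for k
      using less[OF that] card.infinite by fastforce
    then have "finite (X (map b [0..<n]))"
      by (auto simp: X_def)
    from breaker_reply_exists[of r "maker_move \<sigma> b n", OF fin card this]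
    show ?case
      unfolding b[of n] F_def maker_move_def by (rule someI_ex)
  qed
  then have "legal_breaker \<sigma> b n" for n
    by (simp add: legal_breaker_def X)
  then obtain n P Q where legal: "\<And>n. legal_maker \<sigma> b n"
    and "P \<in> \<S>" "congruent P Q" and Q: "Q \<subseteq> maker_marks \<sigma> b n"
    using \<sigma> unfolding winning_strategy_def by blast
  with paved obtain c d where "c \<in> Q" "d \<in> Q" "c \<noteq> d" "d \<in> r c"
    by blast
  with Q obtain i j where ij: "c = maker_move \<sigma> b i" "d = maker_move \<sigma> b j"
    unfolding maker_marks_def by blast
  \<comment> \<open>After round \<open>i\<close> every cell of
    \<open>r (maker_move \<sigma> b i)\<close> is marked, so a later legal move avoids it. Symmetry
    of \<open>r\<close> then covers both orders of \<open>i\<close> and \<open>j\<close>.\<close>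
  have *: "maker_move \<sigma> b j \<notin> r (maker_move \<sigma> b i)" if "i < j" for i j
  proof
    assume "maker_move \<sigma> b j \<in> r (maker_move \<sigma> b i)"
    then have "maker_move \<sigma> b j \<in> maker_marks \<sigma> b (Suc i) \<union> breaker_marks b (Suc i)"
      using reply[of i] by (auto simp: X breaker_marks_def)
    moreover have "maker_marks \<sigma> b (Suc i) \<subseteq> maker_marks \<sigma> b j"
      "breaker_marks b (Suc i) \<subseteq> breaker_marks b j"
      using that by (force simp: maker_marks_def breaker_marks_def)+
    ultimately show False
      using legal[of j] by (auto simp: legal_maker_def)
  qed
  show False
    using *[of i j] *[of j i] \<open>c \<noteq> d\<close> \<open>d \<in> r c\<close> sym[of d c] ij by (cases i j rule: linorder_cases) auto
qed

lemma paving_breaker_wins_dihedral: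
  fixes r :: "cell \<Rightarrow> cell set"
  assumes "\<And>c. finite (r c)" and "\<And>c. card (r c) \<le> 2"
    and "\<And>c d. d \<in> r c \<Longrightarrow> c \<in> r d"
    and "\<And>P w s t a b. P \<in> \<S> \<Longrightarrow> s \<in> {1, -1} \<Longrightarrow> t \<in> {1, -1} \<Longrightarrow>
      \<exists>c\<in>P. \<exists>d\<in>P. dihedral w s t a b d \<in> r (dihedral w s t a b c) \<and>
        dihedral w s t a b c \<noteq> dihedral w s t a b d"
  shows "\<not> maker_wins \<S>"
proof (rule paving_breaker_wins[of r])
  fix P Q assume P: "P \<in> \<S>" "congruent P Q"
  then obtain f where f: "f \<in> board_symmetries" "Q = f ` P"
    by (auto simp: congruent_def)
  obtain w s t a b where "s \<in> {1, -1}" "t \<in> {1, -1}" "Q = dihedral w s t a b ` P"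
    by (rule board_symmetries_dihedral[OF f(1)]) (use f(2) in simp)
  with assms(4)[OF P(1), of s t w a b] show "\<exists>c\<in>Q. \<exists>d\<in>Q. c \<noteq> d \<and> d \<in> r c"
    by blast
qed (use assms in auto)

section \<open>Pavings for the individual losing teams\<close>

lemma S_3: "S_poly 3 = {(0, 0), (1, 0), (2, 0)}"
  by (auto simp: S_poly_def lessThan_Suc numeral_3_eq_3)

lemma S_4: "S_poly 4 = {(0, 0), (1, 0), (2, 0), (3, 0)}"
  by (auto simp: S_poly_def lessThan_Suc eval_nat_numeral)

lemma card_pair_le: "card {p, q} \<le> 2"
  by (simp add: card_insert_if)

text \<open>The paving consists of the vertical lines, and every copy of the corner has a vertical
  leg.\<close>

lemma breaker_wins_N_3_1: "\<not> maker_wins N_3_1"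
proof (rule paving_breaker_wins_dihedral[of "\<lambda>(x, y). {(x, y + 1), (x, y - 1)}"])
  fix P w and s t a b :: int
  assume "P \<in> N_3_1" "s \<in> {1, -1}" "t \<in> {1, -1}"
  then show "\<exists>c\<in>P. \<exists>d\<in>P.
      dihedral w s t a b d \<in> (case dihedral w s t a b c of (x, y) \<Rightarrow> {(x, y + 1), (x, y - 1)}) \<and>
      dihedral w s t a b c \<noteq> dihedral w s t a b d"
    by (auto simp: N_3_1_def L_2_def dihedral_def)
qed (auto simp: card_pair_le)

text \<open>The edges \<open>x \<leftrightarrow> flip x\<close> in both directions are the sides of the blocks of a tiling by
  \<open>2 \<times> 2\<close> squares.\<close>

definition flip :: "int \<Rightarrow> int" where
  "flip x = (if even x then x + 1 else x - 1)"

text \<open>Every copy of \<open>S_3\<close> or \<open>Z_2\<close> contains two parallel dominoes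
  shifted by one along their direction. One of them starts at an even coordinate and is thus a side
  of a block.\<close>

lemma breaker_wins_N_3_2: "\<not> maker_wins N_3_2"
proof (rule paving_breaker_wins_dihedral[of "\<lambda>(x, y). {(flip x, y), (x, flip y)}"])
  fix P w and s t a b :: int
  assume "P \<in> N_3_2" "s \<in> {1, -1}" "t \<in> {1, -1}"
  then show "\<exists>c\<in>P. \<exists>d\<in>P.
      dihedral w s t a b d \<in> (case dihedral w s t a b c of (x, y) \<Rightarrow> {(flip x, y), (x, flip y)}) \<and>
      dihedral w s t a b c \<noteq> dihedral w s t a b d"
    by (cases w; cases "even a"; cases "even b")
      (auto simp: N_3_2_def S_3 Z_2_def dihedral_def flip_def)
qed (auto simp: card_pair_le flip_def split: if_splits)

text \<open>The components are infinite meanders in strips of two columns. Straight trominoes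
  contain two dominoes shifted by one, one of which is an edge. The two vertical dominoes of a
  square start at cells of opposite parity. The staircase has two horizontal dominoes that start in
  consecutive columns.\<close>

lemma breaker_wins_N_3_3: "\<not> maker_wins N_3_3"
proof (rule paving_breaker_wins_dihedral
    [of "\<lambda>(x, y). {(flip x, y), (x, if even (x + y) then y + 1 else y - 1)}"])
  fix P w and s t a b :: int
  assume "P \<in> N_3_3" "s \<in> {1, -1}" "t \<in> {1, -1}"
  then show "\<exists>c\<in>P. \<exists>d\<in>P. dihedral w s t a b d \<in> (case dihedral w s t a b c of
        (x, y) \<Rightarrow> {(flip x, y), (x, if even (x + y) then y + 1 else y - 1)}) \<and>
      dihedral w s t a b c \<noteq> dihedral w s t a b d"
    by (cases w; cases "even a"; cases "even b")
      (auto simp: N_3_3_def S_3 C_2_def P_5_10_def dihedral_def flip_def)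
qed (auto simp: card_pair_le flip_def split: if_splits)

text \<open>This paving, found by a SAT solver, is invariant under the translations by \<open>(1, 1)\<close> and
  \<open>(4, 0)\<close>.\<close>

definition paving_3_4 :: "cell \<Rightarrow> cell set" where
  "paving_3_4 = (\<lambda>(x, y).
     if (x - y) mod 4 = 0 then {(x, y + 1), (x, y - 1)}
     else if (x - y) mod 4 = 1 then {(x, y + 1), (x + 1, y)}
     else if (x - y) mod 4 = 2 then {(x + 1, y), (x - 1, y)}
     else {(x - 1, y), (x, y - 1)})"

lemma mod_4_minus: "(4 * k - 1) mod 4 = (3 :: int)" "(4 * k - 2) mod 4 = (2 :: int)"
  "(4 * k - 3) mod 4 = (1 :: int)"
  by presburger+

text \<open>After this substitution \<open>(x - y) mod 4\<close> simplifies to a numeral for every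
  cell of a copy; \<open>mod_4_minus\<close> covers negative offsets.\<close>

lemma mod_4_cases:
  fixes a b :: int
  obtains k where "a = b + 4 * k" | k where "a = b + 4 * k + 1"
    | k where "a = b + 4 * k + 2" | k where "a = b + 4 * k + 3"
proof -
  have "\<exists>k. a = b + 4 * k \<or> a = b + 4 * k + 1 \<or> a = b + 4 * k + 2 \<or> a = b + 4 * k + 3"
    by presburger
  then show thesis using that by blast
qed

text \<open>Let the class of a cell be \<open>(x - y) mod 4\<close>. The edges join classes 0, 1 and
  3, 0 vertically and classes 1, 2 and 2, 3 horizontally, so the components are infinite staircases
  with steps of length two.\<close>

lemma paving_3_4_sym:
  assumes "d \<in> paving_3_4 c"
  shows "c \<in> paving_3_4 d"
proof -
  obtain x y where c: "c = (x, y)"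
    by (cases c)
  show ?thesis
    using assms unfolding c
    by (cases x y rule: mod_4_cases) (auto simp: paving_3_4_def mod_4_minus)
qed

text \<open>Along a line the classes run cyclically, and two of the four cyclic pairs are edges in
  that direction. Four cells show three of these pairs.\<close>

lemma paving_3_4_S_4:
  "s \<in> {1, -1} \<Longrightarrow> t \<in> {1, -1} \<Longrightarrow>
    \<exists>c\<in>S_poly 4. \<exists>d\<in>S_poly 4. dihedral w s t a b d \<in> paving_3_4 (dihedral w s t a b c) \<and>
    dihedral w s t a b c \<noteq> dihedral w s t a b d"
  unfolding S_4 C_2_def Z_2_def
  by (cases a b rule: mod_4_cases; cases w; elim insertE emptyE)
    (simp_all add: dihedral_def paving_3_4_def mod_4_minus)

text \<open>Each cyclic pair of classes is an edge in exactly one direction, and a square shows its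
  pairs in both directions.\<close>

lemma paving_3_4_C_2:
  "s \<in> {1, -1} \<Longrightarrow> t \<in> {1, -1} \<Longrightarrow>
    \<exists>c\<in>C_2. \<exists>d\<in>C_2. dihedral w s t a b d \<in> paving_3_4 (dihedral w s t a b c) \<and>
    dihedral w s t a b c \<noteq> dihedral w s t a b d"
  unfolding S_4 C_2_def Z_2_def
  by (cases a b rule: mod_4_cases; cases w; elim insertE emptyE)
    (simp_all add: dihedral_def paving_3_4_def mod_4_minus)

text \<open>The two parallel end dominoes either show opposite pairs of classes, one of which is an
  edge in their direction, or show the same pair as the middle domino, which is perpendicular to
  them.\<close>

lemma paving_3_4_Z_2:
  "s \<in> {1, -1} \<Longrightarrow> t \<in> {1, -1} \<Longrightarrow>
    \<exists>c\<in>Z_2. \<exists>d\<in>Z_2. dihedral w s t a b d \<in> paving_3_4 (dihedral w s t a b c) \<and>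
    dihedral w s t a b c \<noteq> dihedral w s t a b d"
  unfolding S_4 C_2_def Z_2_def
  by (cases a b rule: mod_4_cases; cases w; elim insertE emptyE)
    (simp_all add: dihedral_def paving_3_4_def mod_4_minus)

lemma breaker_wins_N_3_4: "\<not> maker_wins N_3_4"
proof (rule paving_breaker_wins_dihedral[OF _ _ paving_3_4_sym])
  fix P w and s t a b :: int
  assume *: "P \<in> N_3_4" "s \<in> {1, -1}" "t \<in> {1, -1}"
  from * show "\<exists>c\<in>P. \<exists>d\<in>P. dihedral w s t a b d \<in> paving_3_4 (dihedral w s t a b c) \<and>
      dihedral w s t a b c \<noteq> dihedral w s t a b d"
    using paving_3_4_S_4[OF *(2,3)] paving_3_4_C_2[OF *(2,3)] paving_3_4_Z_2[OF *(2,3)]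
    unfolding N_3_4_def by blast
qed (simp_all add: card_pair_le paving_3_4_def split: prod.splits)


section \<open>Growing polyominoes\<close>

text \<open>A walk inside \<open>P\<close> from a cell of \<open>A\<close> to a cell outside has a
  step that leaves \<open>A\<close>.\<close>

lemma polyomino_grow:
  assumes P: "polyomino P" and A: "A \<subseteq> P" "A \<noteq> {}" "A \<noteq> P"
  shows "\<exists>a\<in>A. \<exists>c\<in>P - A. adjacent a c"
proof -
  obtain p q where pq: "p \<in> A" "q \<in> P" "q \<notin> A"
    using A by blast
  let ?R = "{(u, v). u \<in> P \<and> v \<in> P \<and> adjacent u v}"
  have "(p, q) \<in> ?R\<^sup>*"
    using P pq A by (auto simp: polyomino_def)
  then show ?thesis
    using pq(1,3)
  proof (induction rule: converse_rtrancl_induct)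
    case base
    then show ?case by simp
  next
    case (step y z)
    then show ?case by (cases "z \<in> A") blast+
  qed
qed

text \<open>The extra cell is pulled back along the embedding, so extensions need to be listed only
  around \<open>A\<close> in its standard position.\<close>

lemma ancestor_grow:
  assumes P: "polyomino P" and A: "A \<sqsubseteq> P" "A \<noteq> {}"
  obtains "congruent A P" | a c where "a \<in> A" "c \<notin> A" "adjacent a c" "insert c A \<sqsubseteq> P"
proof -
  obtain f where f: "f \<in> board_symmetries" "f ` A \<subseteq> P"
    using A by (auto simp: ancestor_iff)
  show thesis
  proof (cases "f ` A = P")
    case True
    then have "congruent A P"
      using f by (auto simp: congruent_def)
    then show thesis by (rule that(1))
  next
    case False
    have "f ` A \<noteq> {}"
      using A by simp
    from polyomino_grow[OF P f(2) this False]
    obtain u c where u: "u \<in> f ` A" "c \<in> P" "c \<notin> f ` A" "adjacent u c"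
      by blast
    obtain g where g: "\<And>p. f (g p) = p"
      by (rule board_symmetries_inverse[OF f(1)]) blast
    obtain a where a: "a \<in> A" "u = f a"
      using u(1) by blast
    have "adjacent (f a) (f (g c))"
      using u(4) a g by simp
    then have "adjacent a (g c)"
      using board_symmetries_adjacent[OF f(1)] by simp
    moreover have "g c \<notin> A"
      using u(3) g by (metis imageI)
    moreover have "insert (g c) A \<sqsubseteq> P"
      using f u(2) g unfolding ancestor_iff by (intro bexI[OF _ f(1)]) simp
    ultimately show thesis
      using that(2) a(1) by blast
  qed
qed

lemma adjacent_cases:
  assumes "adjacent (x, y) c"
  obtains "c = (x + 1, y)" | "c = (x - 1, y)" | "c = (x, y + 1)" | "c = (x, y - 1)"
proof -
  have "c = (x + 1, y) \<or> c = (x - 1, y) \<or> c = (x, y + 1) \<or> c = (x, y - 1)"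
    using assms by (cases c) (auto simp: adjacent_def)
  then show thesis using that by blast
qed

section \<open>Recognizing particular polyominoes inside a cell set\<close>

lemma S_2: "S_poly 2 = {(0, 0), (1, 0)}"
  by (auto simp: S_poly_def lessThan_Suc eval_nat_numeral)

lemma singleton_ancestor: "p \<in> P \<Longrightarrow> {q} \<sqsubseteq> P"
  by (rule ancestor_dihedralI[of False 1 1 "fst p - fst q" "snd p - snd q"])
    (auto simp: dihedral_def split: prod.splits)

lemma S_3_ancestorI:
  "{(x, y), (x + 1, y), (x + 2, y)} \<subseteq> P \<or> {(x, y), (x, y + 1), (x, y + 2)} \<subseteq> P \<Longrightarrow> S_poly 3 \<sqsubseteq> P"
  using ancestor_dihedralI[of False 1 1 x y "S_poly 3" P]
    ancestor_dihedralI[of True 1 1 x y "S_poly 3" P]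
  by (auto simp: S_3 dihedral_def algebra_simps)

lemma C_2_ancestorI:
  "{(x, y), (x + 1, y), (x, y + 1), (x + 1, y + 1)} \<subseteq> P \<Longrightarrow> C_2 \<sqsubseteq> P"
  using ancestor_dihedralI[of False 1 1 x y C_2 P]
  by (auto simp: C_2_def dihedral_def algebra_simps)

text \<open>The two positions are those that arise when a cell is added to
  \<open>L_2\<close>.\<close>

lemma Z_2_ancestorI:
  assumes "{(x, y), (x, y - 1), (x + 1, y - 1), (x + 1, y - 2)} \<subseteq> P \<or>
    {(x, y), (x + 1, y), (x + 1, y - 1), (x + 2, y - 1)} \<subseteq> P"
  shows "Z_2 \<sqsubseteq> P"
  using assms ancestor_dihedralI[of False 1 1 x "y - 1" Z_2 P]
    ancestor_dihedralI[of True "-1" "-1" "x + 1" y Z_2 P]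
  by (auto simp: Z_2_def dihedral_def algebra_simps)

lemma P_5_10_ancestorI:
  "{(x, y), (x + 1, y), (x + 1, y - 1), (x + 2, y - 1), (x + 2, y - 2)} \<subseteq> P \<or>
    {(x, y), (x - 1, y), (x - 1, y + 1), (x - 2, y + 1), (x - 2, y + 2)} \<subseteq> P \<Longrightarrow> P_5_10 \<sqsubseteq> P"
  using ancestor_dihedralI[of False 1 "-1" x y P_5_10 P]
    ancestor_dihedralI[of False "-1" 1 x y P_5_10 P]
  by (auto simp: P_5_10_def dihedral_def algebra_simps)

lemma S_4_ancestorI:
  "{(x, y), (x + 1, y), (x + 2, y), (x + 3, y)} \<subseteq> P \<Longrightarrow> S_poly 4 \<sqsubseteq> P"
  using ancestor_dihedralI[of False 1 1 x y "S_poly 4" P]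
  by (auto simp: S_4 dihedral_def algebra_simps)

lemma S_2_ancestorI: "{(x, y), (x + 1, y)} \<subseteq> P \<or> {(x, y), (x, y + 1)} \<subseteq> P \<Longrightarrow> S_poly 2 \<sqsubseteq> P"
  using ancestor_dihedralI[of False 1 1 x y "S_poly 2" P]
    ancestor_dihedralI[of True 1 1 x y "S_poly 2" P]
  by (auto simp: S_2 dihedral_def algebra_simps)

lemma L_2_ancestorI:
  assumes "h = x + 1 \<or> h = x - 1" "v = y + 1 \<or> v = y - 1" "{(x, y), (h, y), (x, v)} \<subseteq> P"
  shows "L_2 \<sqsubseteq> P"
  by (rule ancestor_dihedralI[of False "h - x" "v - y" x y])
    (use assms in \<open>auto simp: L_2_def dihedral_def\<close>)

section \<open>One-cell extensions of small polyominoes\<close>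

lemma two_cells_S_2:
  assumes P: "polyomino P" and "\<not> (\<exists>p. P = {p})"
  shows "S_poly 2 \<sqsubseteq> P"
proof -
  obtain p where p: "p \<in> P"
    using P by (auto simp: polyomino_def)
  have "{p} \<subseteq> P" "{p} \<noteq> {}" "{p} \<noteq> P"
    using p assms(2) by blast+
  from polyomino_grow[OF P this] obtain c where c: "c \<in> P" and adj: "adjacent p c"
    by blast
  obtain x y where "p = (x, y)"
    by (cases p)
  with p adj have xy: "(x, y) \<in> P" and adj: "adjacent (x, y) c"
    by auto
  from adj show ?thesis
    by (rule adjacent_cases)
      (use xy c S_2_ancestorI[of x y P] S_2_ancestorI[of "x - 1" y P] S_2_ancestorI[of x "y - 1" P] in auto)
qed

lemma S_2_grow:
  assumes "polyomino P" "S_poly 2 \<sqsubseteq> P"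
  shows "congruent (S_poly 2) P \<or> S_poly 3 \<sqsubseteq> P \<or> L_2 \<sqsubseteq> P"
proof (rule ancestor_grow[OF assms])
  fix a c
  let ?Q = "insert c (S_poly 2)"
  assume *: "a \<in> S_poly 2" "c \<notin> S_poly 2" "adjacent a c" "?Q \<sqsubseteq> P"
  have "S_poly 3 \<sqsubseteq> ?Q \<or> L_2 \<sqsubseteq> ?Q"
    using *(1-3) S_3_ancestorI[of 0 0 ?Q]
      S_3_ancestorI[of "-1" 0 ?Q]
      L_2_ancestorI[of 1 0 1 0 ?Q]
      L_2_ancestorI[of 1 0 "-1" 0 ?Q]
      L_2_ancestorI[of 0 1 1 0 ?Q]
      L_2_ancestorI[of 0 1 "-1" 0 ?Q]
    unfolding S_2
    by (elim insertE emptyE; hypsubst; elim adjacent_cases; hypsubst) simp_all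
  then show ?thesis
    using *(4) ancestor_trans by blast
qed (auto simp: S_2)

lemma S_3_grow:
  assumes "polyomino P" "S_poly 3 \<sqsubseteq> P"
  shows "congruent (S_poly 3) P \<or> S_poly 4 \<sqsubseteq> P \<or> L_2 \<sqsubseteq> P"
proof (rule ancestor_grow[OF assms])
  fix a c
  let ?Q = "insert c (S_poly 3)"
  assume *: "a \<in> S_poly 3" "c \<notin> S_poly 3" "adjacent a c" "?Q \<sqsubseteq> P"
  have "S_poly 4 \<sqsubseteq> ?Q \<or> L_2 \<sqsubseteq> ?Q"
    using *(1-3) S_4_ancestorI[of 0 0 ?Q]
      S_4_ancestorI[of "-1" 0 ?Q]
      L_2_ancestorI[of 1 0 1 0 ?Q]
      L_2_ancestorI[of 1 0 "-1" 0 ?Q]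
      L_2_ancestorI[of 0 1 1 0 ?Q]
      L_2_ancestorI[of 0 1 "-1" 0 ?Q]
      L_2_ancestorI[of 1 2 1 0 ?Q]
      L_2_ancestorI[of 1 2 "-1" 0 ?Q]
    unfolding S_3
    by (elim insertE emptyE; hypsubst; elim adjacent_cases; hypsubst) simp_all
  then show ?thesis
    using *(4) ancestor_trans by blast
qed (auto simp: S_3)

text \<open>Of the seven neighbours of the corner, four prolong a leg to three in a row,
  \<open>(1, 1)\<close> completes the square, and \<open>(-1, 1)\<close> and \<open>(1, -1)\<close>
  give \<open>Z_2\<close>.\<close>

lemma L_2_grow:
  assumes "polyomino P" "L_2 \<sqsubseteq> P"
  shows "congruent L_2 P \<or> S_poly 3 \<sqsubseteq> P \<or> C_2 \<sqsubseteq> P \<or> Z_2 \<sqsubseteq> P"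
proof (rule ancestor_grow[OF assms])
  fix a c
  let ?Q = "insert c L_2"
  assume *: "a \<in> L_2" "c \<notin> L_2" "adjacent a c" "?Q \<sqsubseteq> P"
  have "S_poly 3 \<sqsubseteq> ?Q \<or> C_2 \<sqsubseteq> ?Q \<or> Z_2 \<sqsubseteq> ?Q"
    using *(1-3) S_3_ancestorI[of 0 0 ?Q]
      S_3_ancestorI[of "-1" 0 ?Q]
      S_3_ancestorI[of 0 "-1" ?Q]
      C_2_ancestorI[of 0 0 ?Q]
      Z_2_ancestorI[of 0 1 ?Q]
      Z_2_ancestorI[of "-1" 1 ?Q]
    unfolding L_2_def
    by (elim insertE emptyE; hypsubst; elim adjacent_cases; hypsubst) simp_all
  then show ?thesis
    using *(4) ancestor_trans by blast
qed (auto simp: L_2_def)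

text \<open>A neighbour of the square prolongs one of its rows or columns.\<close>

lemma C_2_grow:
  assumes "polyomino P" "C_2 \<sqsubseteq> P"
  shows "congruent C_2 P \<or> S_poly 3 \<sqsubseteq> P"
proof (rule ancestor_grow[OF assms])
  fix a c
  let ?Q = "insert c C_2"
  assume *: "a \<in> C_2" "c \<notin> C_2" "adjacent a c" "?Q \<sqsubseteq> P"
  have "S_poly 3 \<sqsubseteq> ?Q"
    using *(1-3) S_3_ancestorI[of 0 0 ?Q]
      S_3_ancestorI[of "-1" 0 ?Q]
      S_3_ancestorI[of 0 "-1" ?Q]
      S_3_ancestorI[of 0 1 ?Q]
      S_3_ancestorI[of "-1" 1 ?Q]
      S_3_ancestorI[of 1 0 ?Q]
      S_3_ancestorI[of 1 "-1" ?Q]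
    unfolding C_2_def
    by (elim insertE emptyE; hypsubst; elim adjacent_cases; hypsubst) simp_all
  then show ?thesis
    using *(4) ancestor_trans by blast
qed (auto simp: C_2_def)

text \<open>A neighbour makes three in a row, fills a square, or continues the staircase at an
  end.\<close>

lemma Z_2_grow:
  assumes "polyomino P" "Z_2 \<sqsubseteq> P"
  shows "congruent Z_2 P \<or> S_poly 3 \<sqsubseteq> P \<or> C_2 \<sqsubseteq> P \<or> P_5_10 \<sqsubseteq> P"
proof (rule ancestor_grow[OF assms])
  fix a c
  let ?Q = "insert c Z_2"
  assume *: "a \<in> Z_2" "c \<notin> Z_2" "adjacent a c" "?Q \<sqsubseteq> P"
  have "S_poly 3 \<sqsubseteq> ?Q \<or> C_2 \<sqsubseteq> ?Q \<or> P_5_10 \<sqsubseteq> ?Q"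
    using *(1-3) S_3_ancestorI[of 0 0 ?Q]
      S_3_ancestorI[of "-1" 0 ?Q]
      S_3_ancestorI[of 1 "-2" ?Q]
      C_2_ancestorI[of 0 0 ?Q]
      C_2_ancestorI[of 0 "-1" ?Q]
      P_5_10_ancestorI[of "-1" 1 ?Q]
      P_5_10_ancestorI[of 2 "-1" ?Q]
    unfolding Z_2_def
    by (elim insertE emptyE; hypsubst; elim adjacent_cases; hypsubst) simp_all
  then show ?thesis
    using *(4) ancestor_trans by blast
qed (auto simp: Z_2_def)


section \<open>Polyominoes without a bend\<close>

text \<open>Straight polyominoes, finite or infinite, are encoded by their positions on a line, so
  that comparing them becomes a question about order-convex sets of integers.\<close>

definition row_of :: "int set \<Rightarrow> cell set" where
  "row_of I = (\<lambda>i. (i, 0)) ` I"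

definition interval :: "int set \<Rightarrow> bool" where
  "interval I \<longleftrightarrow> (\<forall>x\<in>I. \<forall>z\<in>I. {x..z} \<subseteq> I)"

text \<open>The maps are the isometries of the line; the reversal \<open>s = -1\<close> fits a left
  ray into a right one.\<close>

definition embeds :: "int set \<Rightarrow> int set \<Rightarrow> bool" where
  "embeds I J \<longleftrightarrow> (\<exists>s\<in>{1, -1}. \<exists>a. \<forall>i\<in>I. s * i + a \<in> J)"

lemma embeds_row_of: "embeds I J \<Longrightarrow> row_of I \<sqsubseteq> row_of J"
proof -
  assume "embeds I J"
  then obtain s a where s: "s \<in> {1, -1}" "\<forall>i\<in>I. s * i + a \<in> J"
    unfolding embeds_def by blast
  show ?thesis
    by (rule ancestor_dihedralI[of False s 1 a 0]) (use s in \<open>auto simp: row_of_def dihedral_def\<close>)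
qed

lemma interval_ray:
  assumes "interval I" "I \<noteq> {}"
  shows "bdd_above I \<or> (\<exists>a. {a..} \<subseteq> I)" "bdd_below I \<or> (\<exists>a. {..a} \<subseteq> I)"
proof -
  obtain x where x: "x \<in> I"
    using assms(2) by blast
  have "{x..} \<subseteq> I" if "\<not> bdd_above I"
  proof
    fix y assume y: "y \<in> {x..}"
    obtain z where "z \<in> I" "y < z"
      using \<open>\<not> bdd_above I\<close> by (meson bdd_above.I not_less)
    with y x assms(1) show "y \<in> I"
      by (force simp: interval_def)
  qed
  then show "bdd_above I \<or> (\<exists>a. {a..} \<subseteq> I)"
    by metis
  have "{..x} \<subseteq> I" if "\<not> bdd_below I"
  proof
    fix y assume y: "y \<in> {..x}"
    obtain z where "z \<in> I" "z < y"
      using \<open>\<not> bdd_below I\<close> by (meson bdd_below.I not_less)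
    with y x assms(1) show "y \<in> I"
      by (force simp: interval_def)
  qed
  then show "bdd_below I \<or> (\<exists>a. {..a} \<subseteq> I)"
    by metis
qed

text \<open>The bound of \<open>I\<close> is sent to the end of the ray in \<open>J\<close>, with a
  reversal if the two are bounded on different sides.\<close>

lemma embeds_ray:
  assumes "(\<exists>a. {a..} \<subseteq> J) \<or> (\<exists>a. {..a} \<subseteq> J)" "bdd_above I \<or> bdd_below I"
  shows "embeds I J"
proof -
  consider a m where "{a..} \<subseteq> J" "\<And>i. i \<in> I \<Longrightarrow> i \<le> m"
    | a m where "{a..} \<subseteq> J" "\<And>i. i \<in> I \<Longrightarrow> m \<le> i"
    | a m where "{..a} \<subseteq> J" "\<And>i. i \<in> I \<Longrightarrow> i \<le> m"
    | a m where "{..a} \<subseteq> J" "\<And>i. i \<in> I \<Longrightarrow> m \<le> i"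
    using assms unfolding bdd_above_def bdd_below_def by metis
  then show ?thesis
  proof cases
    case (1 a m)
    then have "\<forall>i\<in>I. - 1 * i + (a + m) \<in> J" by force
    then show ?thesis unfolding embeds_def by blast
  next
    case (2 a m)
    then have "\<forall>i\<in>I. 1 * i + (a - m) \<in> J" by force
    then show ?thesis unfolding embeds_def by blast
  next
    case (3 a m)
    then have "\<forall>i\<in>I. 1 * i + (a - m) \<in> J" by force
    then show ?thesis unfolding embeds_def by blast
  next
    case (4 a m)
    then have "\<forall>i\<in>I. - 1 * i + (a + m) \<in> J" by force
    then show ?thesis unfolding embeds_def by blast
  qed
qed

lemma interval_bounded:
  assumes "interval I" "I \<noteq> {}" "bdd_above I" "bdd_below I"
  obtains a b where "I = {a..b}"
proof -
  obtain l u where "\<And>i. i \<in> I \<Longrightarrow> l \<le> i" "\<And>i. i \<in> I \<Longrightarrow> i \<le> u"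
    using assms(3,4) unfolding bdd_above_def bdd_below_def by metis
  then have "I \<subseteq> {l..u}"
    by auto
  then have fin: "finite I"
    using finite_subset by blast
  have "Min I \<in> I" "Max I \<in> I"
    using fin assms(2) by auto
  then have "{Min I..Max I} \<subseteq> I"
    using assms(1) unfolding interval_def by blast
  moreover have "I \<subseteq> {Min I..Max I}"
    using fin by auto
  ultimately show thesis using that by blast
qed

lemma embeds_bounded:
  "d - c \<ge> b - a \<Longrightarrow> embeds {a..b} {c..d}"
  unfolding embeds_def by (intro bexI[of _ 1] exI[of _ "c - a"]) auto

text \<open>Nonempty intervals are segments, rays or the whole line. Segments compare by length,
  segments and rays fit into any ray, and everything fits into the line.\<close>

lemma embeds_total:
  assumes "interval I" "I \<noteq> {}" "interval J" "J \<noteq> {}"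
  shows "embeds I J \<or> embeds J I"
proof -
  have full: "X = UNIV" if X: "interval X" "X \<noteq> {}" "\<not> (bdd_above X \<or> bdd_below X)" for X
  proof -
    obtain a b where ab: "{a..} \<subseteq> X" "{..b} \<subseteq> X"
      using interval_ray[OF X(1,2)] X(3) by metis
    then have "a \<in> X" "b \<in> X"
      by auto
    then have "{b..a} \<subseteq> X"
      using X(1) unfolding interval_def by blast
    moreover have "y \<in> {a..} \<or> y \<in> {..b} \<or> y \<in> {b..a}" for y
      by auto
    ultimately show ?thesis
      using ab by blast
  qed
  have id: "embeds X UNIV" for X
    unfolding embeds_def by blast
  show ?thesis
  proof (cases "bdd_above I \<and> bdd_below I \<and> bdd_above J \<and> bdd_below J")
    case True
    then obtain a b c d where "I = {a..b}" "J = {c..d}"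
      using interval_bounded assms by metis
    then show ?thesis
      using embeds_bounded[of b a d c] embeds_bounded[of d c b a] by fastforce
  next
    case False
    then show ?thesis
      using full[OF assms(1,2)] full[OF assms(3,4)] id interval_ray[OF assms(1,2)]
        interval_ray[OF assms(3,4)] embeds_ray[of I J] embeds_ray[of J I] by metis
  qed
qed

lemma polyomino_row_interval:
  assumes P: "polyomino P" and row: "\<forall>p\<in>P. snd p = y"
  shows "interval (fst ` P)" "fst ` P \<noteq> {}" "congruent (row_of (fst ` P)) P"
proof -
  show "fst ` P \<noteq> {}"
    using P by (auto simp: polyomino_def)
  show "interval (fst ` P)"
    unfolding interval_def
  proof (intro ballI subsetI)
    fix x z m assume x: "x \<in> fst ` P" and z: "z \<in> fst ` P" and m: "m \<in> {x..z}"
    show "m \<in> fst ` P"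
    proof (rule ccontr)
      assume no: "m \<notin> fst ` P"
      \<comment> \<open>If \<open>m\<close> is a gap, leaving the part of \<open>P\<close> to its
        left needs a step into column \<open>m\<close>.\<close>
      let ?A = "{p \<in> P. fst p < m}"
      have "x \<noteq> m" using no x by auto
      then have "?A \<noteq> {}" using x m by force
      moreover have "?A \<noteq> P" using z m by force
      ultimately obtain a c where ac: "a \<in> ?A" "c \<in> P" "c \<notin> ?A" "adjacent a c"
        using polyomino_grow[OF P, of ?A] by blast
      have "snd a = snd c" using ac row by simp
      then have "fst c = m" using ac by (auto simp: adjacent_def)
      then show False using no ac(2) by auto
    qed
  qed
  have "P = dihedral False 1 1 0 y ` row_of (fst ` P)"
    using row by (force simp: row_of_def dihedral_def image_iff)
  then show "congruent (row_of (fst ` P)) P"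
    unfolding congruent_def by (intro bexI[OF _ dihedral_board_symmetries]) auto
qed

lemma no_bend_straight:
  assumes P: "polyomino P" and "\<not> L_2 \<sqsubseteq> P"
  shows "(\<exists>y. \<forall>p\<in>P. snd p = y) \<or> (\<exists>x. \<forall>p\<in>P. fst p = x)"
proof (rule ccontr)
  assume contra: "\<not> ?thesis"
  obtain p where p: "p \<in> P"
    using P by (auto simp: polyomino_def)
  have bend: "L_2 \<sqsubseteq> P"
    if "a \<in> P" "b \<in> P" "c \<in> P" "adjacent a b" "snd a = snd b" "adjacent a c" "fst a = fst c" for a b c
    by (rule L_2_ancestorI[of "fst b" "fst a" "snd c" "snd a"])
      (use that in \<open>auto simp: adjacent_def prod_eq_iff\<close>, (metis prod.collapse)+)
  have "\<exists>a\<in>P. \<exists>c\<in>P. adjacent a c \<and> fst a = fst c"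
  proof -
    \<comment> \<open>A step out of the row of \<open>p\<close> is vertical; likewise, a step out of
      its column, taken further below, is horizontal.\<close>
    let ?A = "{q \<in> P. snd q = snd p}"
    have "?A \<noteq> {}" "?A \<noteq> P"
      using p contra by blast+
    then obtain a c where "a \<in> ?A" "c \<in> P" "c \<notin> ?A" "adjacent a c"
      using polyomino_grow[OF P, of ?A] by blast
    then show ?thesis
      by (intro bexI[of _ a] bexI[of _ c]) (auto simp: adjacent_def)
  qed
  then obtain a c where ac: "a \<in> P" "c \<in> P" "adjacent a c" "fst a = fst c"
    by blast
  \<comment> \<open>The cells with a horizontal neighbour in \<open>P\<close>. A horizontal step out
    of \<open>?H\<close> would end in \<open>?H\<close>, so the step that leaves it is vertical and
    its start is a bend.\<close>
  let ?H = "{q \<in> P. \<exists>r\<in>P. adjacent q r \<and> snd q = snd r}"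
  have "?H \<noteq> {}"
  proof -
    let ?A = "{q \<in> P. fst q = fst p}"
    have "?A \<noteq> {}" "?A \<noteq> P"
      using p contra by blast+
    then obtain a c where "a \<in> ?A" "c \<in> P" "c \<notin> ?A" "adjacent a c"
      using polyomino_grow[OF P, of ?A] by blast
    then have "a \<in> ?H"
      by (auto simp: adjacent_def intro!: bexI[of _ c])
    then show ?thesis by blast
  qed
  moreover have "?H \<noteq> P"
    using bend[of a _ c] ac assms(2) by blast
  ultimately obtain u v where uv: "u \<in> ?H" "v \<in> P" "v \<notin> ?H" "adjacent u v"
    using polyomino_grow[OF P, of ?H] by blast
  have "adjacent v u"
    using uv(4) by (auto simp: adjacent_def)
  then have "snd u \<noteq> snd v"
    using uv by auto
  then have "fst u = fst v"
    using uv(4) by (auto simp: adjacent_def)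
  then show False
    using bend[of u _ v] uv assms(2) by blast
qed

lemma polyomino_congruent:
  assumes "polyomino P" "f \<in> board_symmetries"
  shows "polyomino (f ` P)"
proof -
  have "(f p, f q) \<in> {(u, v). u \<in> f ` P \<and> v \<in> f ` P \<and> adjacent u v}\<^sup>*"
    if "(p, q) \<in> {(u, v). u \<in> P \<and> v \<in> P \<and> adjacent u v}\<^sup>*" for p q
    using that
  proof induction
    case (step y z)
    then have "(f y, f z) \<in> {(u, v). u \<in> f ` P \<and> v \<in> f ` P \<and> adjacent u v}"
      using board_symmetries_adjacent[OF assms(2)] by auto
    with step.IH show ?case
      by (rule rtrancl_into_rtrancl)
  qed simp
  then show ?thesis
    using assms(1) by (auto simp: polyomino_def)
qed

lemma no_bend_row:
  assumes P: "polyomino P" and L: "\<not> L_2 \<sqsubseteq> P"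
  obtains I where "interval I" "I \<noteq> {}" "congruent (row_of I) P"
  using no_bend_straight[OF assms]
proof (elim disjE exE)
  fix y assume "\<forall>p\<in>P. snd p = y"
  from polyomino_row_interval[OF P this] that show thesis by blast
next
  fix x assume x: "\<forall>p\<in>P. fst p = x"
  have rot: "(\<lambda>(x, y). (- y, x)) \<in> board_symmetries"
    by (rule rotation)
  have "\<forall>p\<in>(\<lambda>(x, y). (- y, x)) ` P. snd p = x"
    using x by auto
  from polyomino_row_interval[OF polyomino_congruent[OF P rot] this]
  obtain I where "interval I" "I \<noteq> {}" "congruent (row_of I) ((\<lambda>(x, y). (- y, x)) ` P)"
    by blast
  moreover have "congruent ((\<lambda>(x, y). (- y, x)) ` P) P"
    by (rule congruent_sym) (use rot in \<open>auto simp: congruent_def\<close>)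
  ultimately show thesis
    using that congruent_trans by blast
qed

lemma no_bend_comparable:
  assumes "polyomino P" "\<not> L_2 \<sqsubseteq> P" "polyomino Q" "\<not> L_2 \<sqsubseteq> Q"
  shows "P \<sqsubseteq> Q \<or> Q \<sqsubseteq> P"
proof -
  obtain I J where I: "interval I" "I \<noteq> {}" "congruent (row_of I) P"
    and J: "interval J" "J \<noteq> {}" "congruent (row_of J) Q"
    using no_bend_row assms by metis
  have "row_of I \<sqsubseteq> row_of J \<or> row_of J \<sqsubseteq> row_of I"
    using embeds_total I(1,2) J(1,2) embeds_row_of by blast
  then show ?thesis
    using I(3) J(3) by (meson ancestor_trans congruent_ancestor congruent_ancestor')
qed


section \<open>Teams of size three\<close>

lemma polyomino_singleton: "polyomino {p}"
  by (simp add: polyomino_def)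

lemma polyomino_insert:
  assumes P: "polyomino P" and a: "a \<in> P" "adjacent a c"
  shows "polyomino (insert c P)"
proof -
  let ?R = "{(u, v). u \<in> insert c P \<and> v \<in> insert c P \<and> adjacent u v}"
  have "adjacent c a"
    using a(2) by (auto simp: adjacent_def)
  then have step: "(a, c) \<in> ?R" "(c, a) \<in> ?R"
    using a by auto
  have conn: "(p, q) \<in> ?R\<^sup>*" if "p \<in> P" "q \<in> P" for p q
  proof (rule rev_subsetD)
    show "(p, q) \<in> {(u, v). u \<in> P \<and> v \<in> P \<and> adjacent u v}\<^sup>*"
      using P that by (simp add: polyomino_def)
  qed (rule rtrancl_mono, auto)
  have "(p, a) \<in> ?R\<^sup>* \<and> (a, p) \<in> ?R\<^sup>*" if "p \<in> insert c P" for p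
    using that conn[of p a] conn[of a p] a(1) step by (auto intro: r_into_rtrancl)
  then have "\<forall>p\<in>insert c P. \<forall>q\<in>insert c P. (p, q) \<in> ?R\<^sup>*"
    by (meson rtrancl_trans)
  then show ?thesis
    unfolding polyomino_def by blast
qed

lemma polyomino_S_3: "polyomino (S_poly 3)"
  and polyomino_S_4: "polyomino (S_poly 4)"
proof -
  have "polyomino {(1, 0), (0, 0)}"
    by (rule polyomino_insert[of _ "(0, 0)"]) (auto simp: adjacent_def polyomino_singleton)
  then have 3: "polyomino {(2, 0), (1, 0), (0, 0)}"
    by (rule polyomino_insert[of _ "(1, 0)"]) (auto simp: adjacent_def)
  then have "polyomino {(3, 0), (2, 0), (1, 0), (0, 0)}"
    by (rule polyomino_insert[of _ "(2, 0)"]) (auto simp: adjacent_def)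
  with 3 show "polyomino (S_poly 3)" "polyomino (S_poly 4)"
    by (simp_all add: S_3 S_4 insert_commute)
qed

lemma polyomino_L_2: "polyomino L_2"
  and polyomino_C_2: "polyomino C_2"
  and polyomino_Z_2: "polyomino Z_2"
  and polyomino_P_5_10: "polyomino P_5_10"
proof -
  have 1: "polyomino {(1, 0), (0, 0)}"
    by (rule polyomino_insert[of _ "(0, 0)"]) (auto simp: adjacent_def polyomino_singleton)
  then have L: "polyomino {(0, 1), (1, 0), (0, 0)}"
    by (rule polyomino_insert[of _ "(0, 0)"]) (auto simp: adjacent_def)
  then have C: "polyomino {(1, 1), (0, 1), (1, 0), (0, 0)}"
    by (rule polyomino_insert[of _ "(1, 0)"]) (auto simp: adjacent_def)
  from L have Z: "polyomino {(1, -1), (0, 1), (1, 0), (0, 0)}"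
    by (rule polyomino_insert[of _ "(1, 0)"]) (auto simp: adjacent_def)
  from 1 have "polyomino {(1, 1), (1, 0), (0, 0)}"
    by (rule polyomino_insert[of _ "(1, 0)"]) (auto simp: adjacent_def)
  then have "polyomino {(2, 1), (1, 1), (1, 0), (0, 0)}"
    by (rule polyomino_insert[of _ "(1, 1)"]) (auto simp: adjacent_def)
  then have "polyomino {(2, 2), (2, 1), (1, 1), (1, 0), (0, 0)}"
    by (rule polyomino_insert[of _ "(2, 1)"]) (auto simp: adjacent_def)
  with L C Z show "polyomino L_2" "polyomino C_2" "polyomino Z_2" "polyomino P_5_10"
    by (simp_all add: L_2_def C_2_def Z_2_def P_5_10_def insert_commute)
qed

section \<open>Incomparability of the particular polyominoes\<close>

lemma ancestor_card:
  assumes "P \<sqsubseteq> Q" "finite Q"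
  shows "card P \<le> card Q"
proof -
  obtain f where "f \<in> board_symmetries" "f ` P \<subseteq> Q"
    using assms(1) by (auto simp: ancestor_iff)
  then show ?thesis
    using assms(2) board_symmetries_inj by (metis card_image card_mono inj_on_subset subset_UNIV)
qed

text \<open>The origin belongs to \<open>P\<close>, so its image already determines the translation vector.\<close>

lemma not_ancestorI:
  assumes "(0, 0) \<in> P"
    and "\<And>w s t a b. (a, b) \<in> Q \<Longrightarrow> s \<in> {1, -1} \<Longrightarrow> t \<in> {1, -1} \<Longrightarrow> w \<in> {True, False} \<Longrightarrow>
      \<not> dihedral w s t a b ` P \<subseteq> Q"
  shows "\<not> P \<sqsubseteq> Q"
proof
  assume "P \<sqsubseteq> Q"
  then obtain w s t a b where *: "s \<in> {1, -1}" "t \<in> {1, -1}" "dihedral w s t a b ` P \<subseteq> Q"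
    by (rule ancestorE)
  have "dihedral w s t a b (0, 0) \<in> Q"
    using assms(1) *(3) by blast
  then have "(a, b) \<in> Q"
    by (simp add: dihedral_def split: if_splits)
  with assms(2)[OF this *(1,2)] *(3) show False
    by blast
qed

lemma not_S_3_ancestor: "\<not> S_poly 3 \<sqsubseteq> C_2" "\<not> S_poly 3 \<sqsubseteq> Z_2" "\<not> S_poly 3 \<sqsubseteq> P_5_10"
  unfolding S_3 C_2_def Z_2_def P_5_10_def
  by (rule not_ancestorI; (elim insertE emptyE Pair_inject; hypsubst)?;
      simp add: dihedral_def)+

lemma S_3_ancestor_S_4: "S_poly 3 \<sqsubseteq> S_poly 4"
  by (rule S_3_ancestorI[of 0 0]) (simp add: S_4)

lemma not_C_2_ancestor: "\<not> C_2 \<sqsubseteq> S_poly 4" "\<not> C_2 \<sqsubseteq> Z_2" "\<not> C_2 \<sqsubseteq> P_5_10"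
  unfolding S_4 C_2_def Z_2_def P_5_10_def
  by (rule not_ancestorI; (elim insertE emptyE Pair_inject; hypsubst)?;
      simp add: dihedral_def)+

lemma not_Z_2_ancestor: "\<not> Z_2 \<sqsubseteq> S_poly 4" "\<not> Z_2 \<sqsubseteq> C_2"
  unfolding S_4 C_2_def Z_2_def
  by (rule not_ancestorI; (elim insertE emptyE Pair_inject; hypsubst)?;
      simp add: dihedral_def)+

lemma finite_particular: "finite (S_poly n)" "finite L_2" "finite C_2" "finite Z_2" "finite P_5_10"
  by (simp_all add: S_poly_def L_2_def C_2_def Z_2_def P_5_10_def)

lemma card_particular: "card (S_poly 3) = 3" "card C_2 = 4" "card Z_2 = 4" "card P_5_10 = 5"
  by (simp_all add: S_3 C_2_def Z_2_def P_5_10_def)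

lemma not_ancestor_by_card:
  "\<not> C_2 \<sqsubseteq> S_poly 3" "\<not> Z_2 \<sqsubseteq> S_poly 3" "\<not> P_5_10 \<sqsubseteq> S_poly 3" "\<not> P_5_10 \<sqsubseteq> C_2"
  by (auto dest!: ancestor_card simp: finite_particular card_particular)

lemma not_S_4_ancestor: "\<not> S_poly 4 \<sqsubseteq> C_2" "\<not> S_poly 4 \<sqsubseteq> Z_2"
  using not_S_3_ancestor S_3_ancestor_S_4 ancestor_trans by blast+

lemmas not_ancestors = not_S_3_ancestor not_C_2_ancestor not_Z_2_ancestor not_S_4_ancestor
  not_ancestor_by_card

lemmas polyomino_particular = polyomino_S_3 polyomino_S_4 polyomino_L_2 polyomino_C_2 polyomino_Z_2
  polyomino_P_5_10

lemma team_Y_3: "team Y_3"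
  by (simp add: team_def Y_3_def polyomino_particular not_ancestors)

lemma team_N_3: "\<N> \<in> {N_3_1, N_3_2, N_3_3, N_3_4} \<Longrightarrow> team \<N>"
  by (auto simp: team_def N_3_1_def N_3_2_def N_3_3_def N_3_4_def polyomino_particular not_ancestors)

section \<open>Classification of teams of size three\<close>

lemma incomparable_contains:
  assumes P: "polyomino P" and Q: "polyomino Q" and "\<not> P \<sqsubseteq> Q" "\<not> Q \<sqsubseteq> P"
  shows "S_poly 3 \<sqsubseteq> P \<or> L_2 \<sqsubseteq> P"
proof -
  have "Q \<noteq> {}" "P \<noteq> {}"
    using P Q by (auto simp: polyomino_def)
  \<comment> \<open>A single cell is an ancestor of every polyomino. Both \<open>P\<close> and
    \<open>Q\<close> thus contain a domino, so \<open>P\<close> is not itself a domino.\<close>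
  then have "\<not> (\<exists>p. P = {p})" "\<not> (\<exists>p. Q = {p})"
    using assms(3,4) singleton_ancestor by blast+
  then have S_2: "S_poly 2 \<sqsubseteq> P" "S_poly 2 \<sqsubseteq> Q"
    using two_cells_S_2 P Q by blast+
  then have "\<not> congruent (S_poly 2) P"
    using assms(3) ancestor_trans congruent_ancestor' by blast
  with S_2_grow[OF P S_2(1)] show ?thesis by blast
qed

text \<open>Here \<open>l\<close> is the straight member. A proper extension of the square contains
  \<open>S_3\<close>, so \<open>A\<close> is the square itself, and \<open>B\<close>, incomparable
  with it, contains no square. If \<open>B\<close> contains neither \<open>S_3\<close> nor the
  staircase, it is \<open>Z_2\<close> itself, and the length of \<open>l\<close> decides.\<close>

lemma classification_straight:
  assumes team: "team {l, A, B}" and neq: "l \<noteq> A" "l \<noteq> B" "A \<noteq> B"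
    and l: "S_poly 3 \<sqsubseteq> l" "\<not> L_2 \<sqsubseteq> l" and A: "\<not> S_poly 3 \<sqsubseteq> A" "\<not> Z_2 \<sqsubseteq> A"
    and B: "S_poly 3 \<sqsubseteq> B \<or> C_2 \<sqsubseteq> B \<or> Z_2 \<sqsubseteq> B" and C_2: "C_2 \<sqsubseteq> A"
  shows "{l, A, B} \<preceq> Y_3 \<or> N_3_3 \<preceq> {l, A, B} \<or> N_3_4 \<preceq> {l, A, B}"
proof -
  have poly: "polyomino l" "polyomino A" "polyomino B"
    and inc: "\<not> A \<sqsubseteq> B"
    using team neq by (auto simp: team_def)
  have A_C_2: "congruent C_2 A"
    using C_2_grow[OF poly(2) C_2] A by blast
  then have noC: "\<not> C_2 \<sqsubseteq> B"
    using inc ancestor_trans congruent_ancestor' by blast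
  show ?thesis
  proof (cases "S_poly 3 \<sqsubseteq> B \<or> P_5_10 \<sqsubseteq> B")
    case True
    then have "N_3_3 \<preceq> {l, A, B}"
      using l(1) C_2 by (auto simp: simpler_def N_3_3_def)
    then show ?thesis by blast
  next
    case False
    then have Z: "Z_2 \<sqsubseteq> B" "congruent Z_2 B"
      using B noC Z_2_grow[OF poly(3)] by blast+
    from S_3_grow[OF poly(1) l(1)] l(2) consider "congruent (S_poly 3) l" | "S_poly 4 \<sqsubseteq> l"
      by blast
    then show ?thesis
    proof cases
      case 1
      then have "{l, A, B} \<preceq> Y_3"
        using A_C_2 Z(2) congruent_ancestor' by (auto simp: simpler_def Y_3_def)
      then show ?thesis by blast
    next
      case 2
      then have "N_3_4 \<preceq> {l, A, B}"
        using C_2 Z(1) by (auto simp: simpler_def N_3_4_def)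
      then show ?thesis by blast
    qed
  qed
qed

lemma classification:
  assumes team: "team \<F>" and card: "card \<F> = 3"
  shows "\<F> \<preceq> Y_3 \<or> (\<exists>\<N>\<in>{N_3_1, N_3_2, N_3_3, N_3_4}. \<N> \<preceq> \<F>)"
proof (cases "\<forall>P\<in>\<F>. L_2 \<sqsubseteq> P")
  case True
  then have "N_3_1 \<preceq> \<F>"
    by (simp add: simpler_def N_3_1_def)
  then show ?thesis by blast
next
  case False
  then obtain l where l: "l \<in> \<F>" "\<not> L_2 \<sqsubseteq> l"
    by blast
  have "card (\<F> - {l}) = 2"
    using card l(1) by simp
  then obtain A B where AB: "\<F> - {l} = {A, B}" "A \<noteq> B"
    by (meson card_2_iff)
  with l(1) have \<F>: "\<F> = {l, A, B}" and neq: "l \<noteq> A" "l \<noteq> B"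
    by blast+
  have poly: "polyomino l" "polyomino A" "polyomino B"
    and inc: "\<not> l \<sqsubseteq> A" "\<not> l \<sqsubseteq> B" "\<not> A \<sqsubseteq> l" "\<not> B \<sqsubseteq> l" "\<not> A \<sqsubseteq> B" "\<not> B \<sqsubseteq> A"
    using team neq \<open>A \<noteq> B\<close> unfolding \<F> by (auto simp: team_def)
  have S_3_l: "S_poly 3 \<sqsubseteq> l"
    using incomparable_contains[OF poly(1,2) inc(1,3)] l(2) by blast
  \<comment> \<open>Two members without a bend would be comparable, so \<open>l\<close> is the only
    one.\<close>
  have L: "L_2 \<sqsubseteq> A" "L_2 \<sqsubseteq> B"
    using no_bend_comparable poly l(2) inc by blast+
  \<comment> \<open>A corner tromino would be an ancestor of the other bent member.\<close>
  then have "\<not> congruent L_2 A" "\<not> congruent L_2 B"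
    using inc ancestor_trans congruent_ancestor' by blast+
  then have A: "S_poly 3 \<sqsubseteq> A \<or> C_2 \<sqsubseteq> A \<or> Z_2 \<sqsubseteq> A" and B: "S_poly 3 \<sqsubseteq> B \<or> C_2 \<sqsubseteq> B \<or> Z_2 \<sqsubseteq> B"
    using L_2_grow poly L by blast+
  consider "S_poly 3 \<sqsubseteq> A \<or> Z_2 \<sqsubseteq> A" "S_poly 3 \<sqsubseteq> B \<or> Z_2 \<sqsubseteq> B"
    | "\<not> S_poly 3 \<sqsubseteq> A" "\<not> Z_2 \<sqsubseteq> A" "C_2 \<sqsubseteq> A" | "\<not> S_poly 3 \<sqsubseteq> B" "\<not> Z_2 \<sqsubseteq> B" "C_2 \<sqsubseteq> B"
    using A B by blast
  then show ?thesis
  proof cases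
    case 1
    then have "N_3_2 \<preceq> \<F>"
      using S_3_l by (auto simp: \<F> simpler_def N_3_2_def)
    then show ?thesis by blast
  next
    case 2
    then show ?thesis
      using classification_straight[of l A B] team neq \<open>A \<noteq> B\<close> S_3_l l(2) B unfolding \<F> by blast
  next
    case 3
    have "\<F> = {l, B, A}"
      using \<F> by blast
    with 3 show ?thesis
      using classification_straight[of l B A] team neq \<open>A \<noteq> B\<close> S_3_l l(2) A by blast
  qed
qed


section \<open>Winners and simplicity\<close>

text \<open>Every bounded restriction of \<open>\<S>\<close> is simpler than \<open>\<S>\<close>,
  hence than \<open>\<T>\<close>.\<close>

lemma simpler_maker_wins_winner:
  assumes "maker_wins \<T>" "\<S> \<preceq> \<T>"
  shows "winner \<S>"
proof (cases "unbounded \<S>")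
  case True
  have "maker_wins \<R>" if "bounded_restriction \<R> \<S>" for \<R>
  proof -
    have "\<R> \<preceq> \<S>"
      using that by (auto simp: bounded_restriction_def simpler_def)
    then show ?thesis
      using assms maker_wins_simpler simpler_trans by blast
  qed
  with True show ?thesis by (simp add: winner_def)
next
  case False
  with assms maker_wins_simpler show ?thesis
    by (auto simp: winner_def)
qed

text \<open>In the unbounded case, choosing for each member of \<open>\<S>\<close> an ancestor in
  \<open>\<N>\<close> gives a bounded restriction that the maker loses.\<close>

lemma simpler_maker_loses_loser:
  assumes lose: "\<not> maker_wins \<N>" and poly: "\<forall>P\<in>\<N>. polyomino P \<and> finite P" and simpler: "\<N> \<preceq> \<S>"
  shows "loser \<S>"
proof (cases "unbounded \<S>")
  case True
  have "\<forall>Q\<in>\<S>. \<exists>P. P \<in> \<N> \<and> P \<sqsubseteq> Q"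
    using simpler by (auto simp: simpler_def)
  then obtain F where F: "\<forall>Q\<in>\<S>. F Q \<in> \<N> \<and> F Q \<sqsubseteq> Q"
    using bchoice[of \<S> "\<lambda>Q P. P \<in> \<N> \<and> P \<sqsubseteq> Q"] by blast
  then have "bounded_restriction (F ` \<S>) \<S>"
    using True poly unfolding bounded_restriction_def by blast
  moreover have "\<N> \<preceq> F ` \<S>"
    using F ancestor_refl by (auto simp: simpler_def)
  then have "\<not> maker_wins (F ` \<S>)"
    using lose maker_wins_simpler by blast
  ultimately show ?thesis
    using True by (auto simp: winner_def)
next
  case False
  with lose simpler maker_wins_simpler show ?thesis
    by (auto simp: winner_def)
qed

lemma N_3_loses:
  assumes "\<N> \<in> {N_3_1, N_3_2, N_3_3, N_3_4}" "\<N> \<preceq> \<S>"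
  shows "loser \<S>"
proof (rule simpler_maker_loses_loser[OF _ _ assms(2)])
  show "\<not> maker_wins \<N>"
    using assms(1) breaker_wins_N_3_1 breaker_wins_N_3_2 breaker_wins_N_3_3 breaker_wins_N_3_4
    by blast
  show "\<forall>P\<in>\<N>. polyomino P \<and> finite P"
    using assms(1) polyomino_particular finite_particular
    by (auto simp: N_3_1_def N_3_2_def N_3_3_def N_3_4_def)
qed


section \<open>The maker wins \<open>Y_3\<close>\<close>

text \<open>A strategy sees only the breaker's moves; the maker's own cells are recovered by
  replaying \<open>pick\<close> on the history.\<close>

lemma strategy_from_positions:
  fixes pick :: "cell set \<Rightarrow> cell set \<Rightarrow> cell"
  obtains \<sigma> where "\<And>b n. maker_move \<sigma> b n = pick (maker_marks \<sigma> b n) (breaker_marks b n)"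
proof -
  \<comment> \<open>The history is read newest first. The move before the reply \<open>B\<close> was
    made against the older moves \<open>bs\<close> alone, so \<open>B\<close> does not enter the
    call of \<open>pick\<close>.\<close>
  define own where "own = rec_list {} (\<lambda>_ bs M. insert (pick M (\<Union>(set bs))) M)"
  have own: "own [] = {}" "\<And>B bs. own (B # bs) = insert (pick (own bs) (\<Union>(set bs))) (own bs)"
    by (simp_all add: own_def)
  define \<sigma> where "\<sigma> h = pick (own (rev h)) (\<Union>(set h))" for h
  have breaker: "\<Union>(set (map b [0..<n])) = breaker_marks b n" for b n
    by (auto simp: breaker_marks_def)
  have "own (rev (map b [0..<n])) = maker_marks \<sigma> b n" for b n
  proof (induction n)
    case 0
    then show ?case by (simp add: own maker_marks_def)
  next
    case (Suc n)
    then show ?case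
      by (simp add: own maker_marks_def lessThan_Suc maker_move_def \<sigma>_def)
  qed
  then have "maker_move \<sigma> b n = pick (maker_marks \<sigma> b n) (breaker_marks b n)" for b n
    unfolding maker_move_def \<sigma>_def breaker by simp
  then show thesis by (rule that)
qed

definition Y_3_reached :: "cell set \<Rightarrow> bool" where
  "Y_3_reached M \<longleftrightarrow> (\<exists>P\<in>Y_3. P \<sqsubseteq> M)"

text \<open>Completing a goal has priority over a neighbouring cell, and that over an arbitrary free
  cell; hence the alternative in the third property.\<close>

lemma greedy_pick:
  obtains pick where
    "\<And>M B. finite M \<Longrightarrow> finite B \<Longrightarrow> pick M B \<notin> M \<union> B"
    "\<And>M B c. c \<notin> M \<union> B \<Longrightarrow> Y_3_reached (insert c M) \<Longrightarrow> Y_3_reached (insert (pick M B) M)"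
    "\<And>M B a c. a \<in> M \<Longrightarrow> adjacent a c \<Longrightarrow> c \<notin> M \<union> B \<Longrightarrow>
      Y_3_reached (insert (pick M B) M) \<or> (\<exists>a\<in>M. adjacent a (pick M B))"
proof -
  define free where "free M B c \<longleftrightarrow> c \<notin> M \<union> B" for M B :: "cell set" and c
  define win where "win M B c \<longleftrightarrow> free M B c \<and> Y_3_reached (insert c M)" for M B c
  define near where "near M B c \<longleftrightarrow> free M B c \<and> (\<exists>a\<in>M. adjacent a c)" for M B c
  define pick where "pick M B = (if Ex (win M B) then Eps (win M B)
    else if Ex (near M B) then Eps (near M B) else Eps (free M B))" for M B
  have win: "win M B (pick M B)" if "win M B c" for M B c
  proof -
    have "Ex (win M B)"
      using that by (rule exI)
    then show ?thesis
      unfolding pick_def by (simp only: if_True someI_ex)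
  qed
  have near: "near M B (pick M B)" if "near M B c" "\<not> Ex (win M B)" for M B c
  proof -
    have "Ex (near M B)"
      using that(1) by (rule exI)
    with that(2) show ?thesis
      unfolding pick_def by (simp only: if_True if_False someI_ex)
  qed
  have free: "free M B (pick M B)" if "free M B c" for M B c
  proof -
    consider d where "win M B d" | d where "near M B d" "\<not> Ex (win M B)"
      | "\<not> Ex (win M B)" "\<not> Ex (near M B)"
      by metis
    then show ?thesis
    proof cases
      case 1
      from win[OF this] show ?thesis by (simp only: win_def)
    next
      case 2
      from near[OF this] show ?thesis by (simp only: near_def)
    next
      case 3
      have "Ex (free M B)"
        using that by (rule exI)
      with 3 show ?thesis
        unfolding pick_def by (simp only: if_False someI_ex)
    qed
  qed
  have "Ex (free M B)" if "finite M" "finite B" for M B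
  proof -
    have "infinite (UNIV :: cell set)"
      by (simp add: infinite_UNIV_char_0 finite_prod)
    then have "M \<union> B \<noteq> UNIV"
      using that by (metis finite_Un)
    then show ?thesis
      by (auto simp: free_def)
  qed
  then have 1: "finite M \<Longrightarrow> finite B \<Longrightarrow> pick M B \<notin> M \<union> B" for M B
    using free unfolding free_def by blast
  have 2: "Y_3_reached (insert (pick M B) M)" if "c \<notin> M \<union> B" "Y_3_reached (insert c M)" for M B c
    using win[of M B c] that by (auto simp: win_def free_def)
  have 3: "Y_3_reached (insert (pick M B) M) \<or> (\<exists>a\<in>M. adjacent a (pick M B))"
    if "a \<in> M" "adjacent a c" "c \<notin> M \<union> B" for M B a c
  proof (cases "Ex (win M B)")
    case True
    then show ?thesis using win by (auto simp: win_def)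
  next
    case False
    have "near M B c"
      using that by (auto simp: near_def free_def)
    from near[OF this False] show ?thesis
      by (auto simp: near_def)
  qed
  show thesis
    using 1 2 3 by (rule that)
qed

section \<open>Shapes and free neighbours in the first rounds\<close>

lemma exists_outside:
  assumes "finite N" "finite B" "card B < card N"
  shows "\<exists>c\<in>N. c \<notin> B"
  using assms card_mono[of B N] by force

lemma domino_shape:
  assumes "adjacent p c"
  shows "congruent (S_poly 2) {p, c}"
proof -
  obtain x y where p: "p = (x, y)"
    by (cases p)
  have shape: "congruent (S_poly 2) {(x, y), c}"
    if "s \<in> {1, -1}" "t \<in> {1, -1}" "{(x, y), c} = dihedral w s t x y ` S_poly 2" for w s t
    unfolding congruent_def that(3) using that(1,2) dihedral_board_symmetries by blast
  from assms have "adjacent (x, y) c"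
    unfolding p .
  then have "congruent (S_poly 2) {(x, y), c}"
  proof (cases rule: adjacent_cases)
    case 1
    then show ?thesis by (intro shape[of 1 1 False]) (auto simp: S_2 dihedral_def)
  next
    case 2
    then show ?thesis by (intro shape[of "-1" 1 False]) (auto simp: S_2 dihedral_def)
  next
    case 3
    then show ?thesis by (intro shape[of 1 1 True]) (auto simp: S_2 dihedral_def)
  next
    case 4
    then show ?thesis by (intro shape[of 1 "-1" True]) (auto simp: S_2 dihedral_def)
  qed
  then show ?thesis
    unfolding p .
qed

lemma S_3_reached: "S_poly 3 \<sqsubseteq> M \<Longrightarrow> Y_3_reached M"
  by (auto simp: Y_3_reached_def Y_3_def)

text \<open>Two of the six neighbours prolong the domino; each of the other four makes a corner with
  its bend at one of the two cells.\<close>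

lemma domino_next_to:
  assumes "a \<in> S_poly 2" "adjacent a c" "c \<notin> S_poly 2"
  shows "S_poly 3 \<sqsubseteq> insert c (S_poly 2) \<or> congruent L_2 (insert c (S_poly 2))"
proof -
  let ?Q = "insert c (S_poly 2)"
  have cong: "congruent L_2 ?Q"
    if "s \<in> {1, -1}" "t \<in> {1, -1}" "?Q = dihedral False s t z 0 ` L_2" for s t z
    unfolding congruent_def that(3) using that(1,2) dihedral_board_symmetries by blast
  have "c \<in> {(-1, 0), (2, 0), (0, 1), (0, -1), (1, 1), (1, -1)}"
    using assms unfolding S_2 by (elim insertE emptyE; hypsubst; elim adjacent_cases; hypsubst) simp_all
  then consider "c = (-1, 0) \<or> c = (2, 0)" | t where "t \<in> {1, -1}" "c = (0, t)"
    | t where "t \<in> {1, -1}" "c = (1, t)"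
    by blast
  then show ?thesis
  proof cases
    case 1
    then show ?thesis
      using S_3_ancestorI[of "-1" 0 ?Q] S_3_ancestorI[of 0 0 ?Q] by (auto simp: S_2)
  next
    case (2 t)
    then have "?Q = dihedral False 1 t 0 0 ` L_2"
      by (auto simp: S_2 L_2_def dihedral_def)
    with cong[of 1 t 0] 2(1) show ?thesis by blast
  next
    case (3 t)
    then have "?Q = dihedral False (-1) t 1 0 ` L_2"
      by (auto simp: S_2 L_2_def dihedral_def)
    with cong[of "-1" t 1] 3(1) show ?thesis by blast
  qed
qed

lemma image_reached: "f \<in> board_symmetries \<Longrightarrow> P \<sqsubseteq> Q \<Longrightarrow> P \<sqsubseteq> f ` Q"
  by (rule ancestor_trans) (auto simp: ancestor_iff)

lemma congruent_image: "f \<in> board_symmetries \<Longrightarrow> congruent P (f ` P)"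
  by (auto simp: congruent_def)

lemma domino_free_neighbour:
  assumes "congruent (S_poly 2) M" "finite B" "card B \<le> 4"
  shows "\<exists>a\<in>M. \<exists>c. adjacent a c \<and> c \<notin> M \<union> B"
proof -
  obtain f where f: "f \<in> board_symmetries" and M: "M = f ` S_poly 2"
    using assms(1) by (auto simp: congruent_def)
  \<comment> \<open>The neighbours of the standard domino. As \<open>f\<close> is injective, their
    images are six cells, more than \<open>B\<close> contains.\<close>
  let ?N = "{(-1, 0), (2, 0), (0, 1), (0, -1), (1, 1), (1, -1)} :: cell set"
  have "card (f ` ?N) = card ?N"
    using board_symmetries_inj[OF f] by (meson card_image inj_on_subset subset_UNIV)
  moreover have "card ?N = 6"
    by simp
  ultimately obtain c where c: "c \<in> ?N" "f c \<notin> B"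
    using exists_outside[of "f ` ?N" B] assms(2,3) by auto
  have "\<exists>a\<in>S_poly 2. adjacent a c"
    using c(1) unfolding S_2 by (elim insertE emptyE; hypsubst) (simp_all add: adjacent_def)
  then obtain a where a: "a \<in> S_poly 2" "adjacent a c"
    by blast
  have "f a \<in> M"
    unfolding M using a(1) by (rule imageI)
  moreover have "adjacent (f a) (f c)"
    unfolding board_symmetries_adjacent[OF f] by (rule a(2))
  moreover have "c \<notin> S_poly 2"
    using c(1) unfolding S_2 by (elim insertE emptyE; hypsubst) simp_all
  then have "f c \<notin> M"
    using M board_symmetries_inj[OF f] by (simp add: inj_image_mem_iff)
  ultimately show ?thesis
    using c(2) by blast
qed

lemma corner_wins:
  assumes "congruent L_2 M" "finite B" "card B \<le> 6"
  shows "\<exists>c. c \<notin> M \<union> B \<and> Y_3_reached (insert c M)"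
proof -
  obtain f where f: "f \<in> board_symmetries" and M: "M = f ` L_2"
    using assms(1) by (auto simp: congruent_def)
  \<comment> \<open>The neighbours of the standard corner; their seven images cannot all lie in
    \<open>B\<close>.\<close>
  let ?N = "{(-1, 0), (2, 0), (0, 2), (0, -1), (1, 1), (-1, 1), (1, -1)} :: cell set"
  have "card (f ` ?N) = card ?N"
    using board_symmetries_inj[OF f] by (meson card_image inj_on_subset subset_UNIV)
  moreover have "card ?N = 7"
    by simp
  ultimately obtain c where c: "c \<in> ?N" "f c \<notin> B"
    using exists_outside[of "f ` ?N" B] assms(2,3) by auto
  have "c \<notin> L_2"
    using c(1) unfolding L_2_def by (elim insertE emptyE; hypsubst) simp_all
  then have "f c \<notin> M"
    using M board_symmetries_inj[OF f] by (simp add: inj_image_mem_iff)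
  let ?Q = "insert c L_2"
  have "S_poly 3 \<sqsubseteq> ?Q \<or> C_2 \<sqsubseteq> ?Q \<or> Z_2 \<sqsubseteq> ?Q"
    using c(1) S_3_ancestorI[of 0 0 ?Q] S_3_ancestorI[of "-1" 0 ?Q] S_3_ancestorI[of 0 "-1" ?Q]
      C_2_ancestorI[of 0 0 ?Q] Z_2_ancestorI[of 0 1 ?Q] Z_2_ancestorI[of "-1" 1 ?Q]
    unfolding L_2_def by (elim insertE emptyE; hypsubst) simp_all
  then have "Y_3_reached (insert (f c) M)"
    using image_reached[OF f, of _ ?Q] by (auto simp: Y_3_reached_def Y_3_def M)
  with \<open>f c \<notin> M\<close> c(2) show ?thesis by blast
qed

lemma maker_wins_Y_3: "maker_wins Y_3"
proof -
  obtain pick where pick_free: "\<And>M B. finite M \<Longrightarrow> finite B \<Longrightarrow> pick M B \<notin> M \<union> B"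
    and pick_win: "\<And>M B c. c \<notin> M \<union> B \<Longrightarrow> Y_3_reached (insert c M) \<Longrightarrow>
      Y_3_reached (insert (pick M B) M)"
    and pick_near: "\<And>M B a c. a \<in> M \<Longrightarrow> adjacent a c \<Longrightarrow> c \<notin> M \<union> B \<Longrightarrow>
      Y_3_reached (insert (pick M B) M) \<or> (\<exists>a\<in>M. adjacent a (pick M B))"
    by (rule greedy_pick) blast
  obtain \<sigma> where \<sigma>: "\<And>b n. maker_move \<sigma> b n = pick (maker_marks \<sigma> b n) (breaker_marks b n)"
    by (rule strategy_from_positions[of pick]) blast
  have "winning_strategy Y_3 \<sigma>"
    unfolding winning_strategy_iff
  proof (intro allI impI conjI)
    fix b assume breaker: "\<forall>n. legal_breaker \<sigma> b n"
    have card: "card (b n) = 2" for n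
      using breaker by (simp add: legal_breaker_def)
    have fin_b: "finite (b n)" for n
      by (rule card_ge_0_finite) (simp add: card)
    define M where "M = maker_marks \<sigma> b"
    define B where "B = breaker_marks b"
    have finB: "finite (B n)" for n
      using fin_b by (simp add: B_def breaker_marks_def)
    have finM: "finite (M n)" for n
      by (simp add: M_def maker_marks_def)
    \<comment> \<open>Index \<open>n\<close> is the position after \<open>n\<close> full rounds,
      just before the maker's next move.\<close>
    have cardB: "card (B n) \<le> 2 * n" for n
    proof -
      have "card (B n) \<le> (\<Sum>k<n. card (b k))"
        unfolding B_def breaker_marks_def by (rule card_UN_le) simp
      then show ?thesis by (simp add: card)
    qed
    have free: "pick (M n) (B n) \<notin> M n \<union> B n" for n
      using pick_free finM finB by blast
    show "legal_maker \<sigma> b n" for n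
      using free[of n] by (simp add: legal_maker_def \<sigma> M_def B_def)
    have "M (Suc n) = insert (maker_move \<sigma> b n) (M n)" for n
      by (simp add: M_def maker_marks_def lessThan_Suc)
    then have M_Suc: "M (Suc n) = insert (pick (M n) (B n)) (M n)" for n
      by (simp add: \<sigma> M_def B_def)
    have M_0: "M 0 = {}"
      by (simp add: M_def maker_marks_def)
    have "\<exists>n. Y_3_reached (M n)"
    proof (rule ccontr)
      assume "\<not> ?thesis"
      \<comment> \<open>If no goal is ever reached, the winning alternative of
        \<open>pick_near\<close> never occurs, so the maker's cells stay connected as long as a free
        neighbour exists.\<close>
      then have never: "\<not> Y_3_reached (insert (pick (M n) (B n)) (M n))" for n
        using M_Suc by metis
      have near: "\<exists>a\<in>M n. adjacent a (pick (M n) (B n))"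
        if "a \<in> M n" "adjacent a c" "c \<notin> M n \<union> B n" for a c n
        using pick_near[OF that] never by metis
      obtain p where M_1: "M (Suc 0) = {p}"
        using M_Suc[of 0] M_0 by auto
      obtain x y where p: "p = (x, y)"
        by (cases p)
      let ?N = "{(x + 1, y), (x - 1, y), (x, y + 1), (x, y - 1)}"
      have "card ?N = 4"
        by simp
      then obtain c where "c \<in> ?N" "c \<notin> B (Suc 0)"
        using exists_outside[of ?N "B (Suc 0)"] finB cardB[of "Suc 0"] by auto
      then have "adjacent p c" "c \<notin> M (Suc 0) \<union> B (Suc 0)"
        by (auto simp: p M_1 adjacent_def)
      then have "adjacent p (pick (M (Suc 0)) (B (Suc 0)))"
        using near[of p "Suc 0" c] by (simp add: M_1)
      from domino_shape[OF this] have M_2: "congruent (S_poly 2) (M 2)"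
        using M_Suc[of "Suc 0"] by (simp only: M_1 numeral_2_eq_2 insert_commute)
      let ?c = "pick (M 2) (B 2)"
      have "card (B 2) \<le> 4"
        using cardB[of 2] by simp
      from domino_free_neighbour[OF M_2 finB[of 2] this] near
      obtain a where a: "a \<in> M 2" "adjacent a ?c"
        by metis
      \<comment> \<open>The third cell is pulled back to the standard domino, where
        \<open>domino_next_to\<close> gives the shapes.\<close>
      obtain f where f: "f \<in> board_symmetries" and fM: "M 2 = f ` S_poly 2"
        using M_2 by (auto simp: congruent_def)
      obtain g where g: "\<And>p. f (g p) = p"
        by (rule board_symmetries_inverse[OF f]) blast
      obtain a' where a': "a' \<in> S_poly 2" "a = f a'"
        using a(1) fM by blast
      have "adjacent (f a') (f (g ?c))"
        using a(2) a' g by simp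
      then have adj: "adjacent a' (g ?c)"
        using board_symmetries_adjacent[OF f] by simp
      have "g ?c \<notin> S_poly 2"
        using free[of 2] fM g by (metis UnI1 imageI)
      from domino_next_to[OF a'(1) adj this]
      have "S_poly 3 \<sqsubseteq> f ` insert (g ?c) (S_poly 2) \<or> congruent L_2 (f ` insert (g ?c) (S_poly 2))"
        using image_reached[OF f] congruent_image[OF f] congruent_trans by blast
      moreover have "f ` insert (g ?c) (S_poly 2) = M 3"
        using M_Suc[of 2] fM g by (simp add: numeral_3_eq_3 numeral_2_eq_2)
      \<comment> \<open>Three in a row would already be a goal. The corner can be completed in the
        next move, against \<open>never\<close>.\<close>
      ultimately have "congruent L_2 (M 3)"
        using S_3_reached \<open>\<not> (\<exists>n. Y_3_reached (M n))\<close> by auto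
      from corner_wins[OF this finB[of 3]] cardB[of 3] pick_win[of _ "M 3" "B 3"] never[of 3]
      show False by auto
    qed
    then show "\<exists>n. \<exists>P\<in>Y_3. P \<sqsubseteq> maker_marks \<sigma> b n"
      by (simp add: Y_3_reached_def M_def)
  qed
  then show ?thesis
    by (auto simp: maker_wins_def)
qed

theorem proposition6p4:
  "(team Y_3 \<and> winner Y_3) \<and>
   (\<forall>\<N>\<in>{N_3_1, N_3_2, N_3_3, N_3_4}. team \<N> \<and> loser \<N>) \<and>
   (\<forall>\<F>. team \<F> \<and> card \<F> = 3 \<longrightarrow>
      \<F> \<preceq> Y_3 \<or> (\<exists>\<N>\<in>{N_3_1, N_3_2, N_3_3, N_3_4}. \<N> \<preceq> \<F>)) \<and>
   (\<forall>\<F>. team \<F> \<and> card \<F> = 3 \<longrightarrow> (winner \<F> \<longleftrightarrow> \<F> \<preceq> Y_3))"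
proof -
  have refl: "\<S> \<preceq> \<S>" for \<S>
    using ancestor_refl by (auto simp: simpler_def)
  have "winner Y_3"
    using simpler_maker_wins_winner[OF maker_wins_Y_3 refl] .
  moreover have "loser \<N>" if "\<N> \<in> {N_3_1, N_3_2, N_3_3, N_3_4}" for \<N>
    using N_3_loses[OF that refl] .
  moreover have "winner \<F> \<longleftrightarrow> \<F> \<preceq> Y_3" if "team \<F>" "card \<F> = 3" for \<F>
    using classification[OF that] simpler_maker_wins_winner[OF maker_wins_Y_3] N_3_loses by blast
  ultimately show ?thesis
    using team_Y_3 team_N_3 classification by simp
qed

end
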